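(* Let $X$ be a finite nonempty set and suppose that $\sigma$ is a cherry picking sequence for two forests $\mathcal F$ and $\mathcal F'$ on $X$. Then there is a phylogenetic network $\mathcal N$ on $X$ that displays $\mathcal F$ and $\mathcal F'$ with $w(\sigma)\ge r(\mathcal N)$.
   Context: All graphs are finite multigraphs without loops. A leaf is a vertex of degree at most one. Suppressing a degree-two vertex $v$ with incident edges $\{u,v\},\{v,w\}$, $u\neq w$, means deleting $v$ and these edges and adding $\{u,w\}$. A phylogenetic network on a finite nonempty set $X$ is a simple connected graph $\mathcal N=(V,E)$ whose set of leaves is exactly $X$ and in which every non-leaf vertex has degree three; if $X=\{x\}$ the single vertex $x$ is a phylogenetic network. $r(\mathcal N)=|E|-(|V|-1)$. A phylogenetic tree on $X$ is a phylogenetic network on $X$ with no cycles. A forest on $X$ is a set of phylogenetic trees whose leaf sets are pairwise disjoint with union $X$. A phylogenetic tree $\mathcal T$ on $Y\subseteq X$ is displayed by $\mathcal N$ if $\mathcal T$ can be obtained from some subtree $\mathcal N[\mathcal T]$ of $\mathcal N$ by suppressing all its degree-two vertices; $\mathcal N$ displays a forest $\mathcal F$ on $X$ if every tree of $\mathcal F$ is displayed by $\mathcal N$ with the subtrees $\mathcal N[\mathcal T]$, $\mathcal T\in\mathcal F$, chosen pairwise vertex-disjoint. Forest notions: a cherry of a phylogenetic tree $\mathcal T$ is a pair $(x,y)$ of distinct leaves such that either $\mathcal T$ is the single edge $\{x,y\}$ or $x,y$ are adjacent to a common vertex; a cherry of a forest is a cherry of one of its trees. For a leaf $x$, $e_x$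 denotes the edge containing $x$. A phylogenetic tree $\mathcal S$ is a proper pendant subtree of a tree $\mathcal T$ if there is a cut-edge $e$ of $\mathcal T$ such that $\mathcal S$ equals one of the two components obtained by deleting $e$ and suppressing degree-two vertices; this edge is $e_{\mathcal S}$ (for $\mathcal S$ a single leaf $p$, $e_{\mathcal S}=e_p$). $((x,y),p)$ denotes a proper pendant subtree with leaf set $\{x,y,p\}$ in which $(x,y)$ is a cherry, and $((x,y),(p,q))$ one with leaf set $\{x,y,p,q\}$ in which $(x,y)$ and $(p,q)$ are cherries; $(p,q)$ also denotes the two-leaf pendant subtree on $\{p,q\}$. For an edge $e$ of a tree $\mathcal T_e$ in a forest $\mathcal F$, $\mathcal F-e$ replaces $\mathcal T_e$ by the trees obtained from $\mathcal T_e$ by deleting $e$ and suppressing degree-two vertices. For $x\in X$, $|X|\ge2$, with $\mathcal T_x$ the tree containing $x$, $\mathcal F-x$ removes $\mathcal T_x$ if it is the single vertex $x$ and otherwise replaces $\mathcal T_x$ by the tree obtained by deleting $x$ and $e_x$ and suppressing the resulting degree-two vertex. Cherry picking sequence: for forests $\mathcal F,\mathcal F'$ on $X$, a sequence $\sigma=(x_1,\dots,x_m)$ of elements of $X$, $m\ge|X|\ge1$, is a cherry picking sequence for $\mathcal F$ and $\mathcal F'$ if there are forests $\mathcal F[i],\mathcal F'[i]$, $1\le i\le m$, with $\mathcal F[1]=\mathcal F$, $\mathcal F'[1]=\mathcal F'$, $\mathcal F[m]=\mathcal F'[m]=\{x_m\}$, and for each $1\le i\le m-1$ precisely one of: (C1)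 $(x_i,y)$ is a cherry in both $\mathcal F[i]$ and $\mathcal F'[i]$ for some $y$, and $\mathcal F[i+1]=\mathcal F[i]-x_i$, $\mathcal F'[i+1]=\mathcal F'[i]-x_i$; (C2) $(x_i,y)$ is a cherry in $\mathcal F[i]$ for some $y$ and one of: (a) $(x_i,z)$ is a cherry in $\mathcal F'[i]$ with $z\ne y$, $\mathcal F'[i+1]=\mathcal F'[i]$, and either (i) $\mathcal F[i+1]$ is $\mathcal F[i]-e_{x_i}$ or $\mathcal F[i]-e_y$, or (ii) $((x_i,y),p)$ is a proper pendant subtree of a tree in $\mathcal F[i]$, $p\in X$, and $\mathcal F[i+1]=\mathcal F[i]-e_{\mathcal S}$ for some $\mathcal S\in\{p,((x_i,y),p)\}$, or (iii) $((x_i,y),(p,q))$ is a proper pendant subtree of a tree in $\mathcal F[i]$, $p\ne q\in X$, and $\mathcal F[i+1]=\mathcal F[i]-e_{\mathcal S}$ for some $\mathcal S\in\{p,q,(p,q)\}$; (b) $x_i,y$ are leaves of one tree $\mathcal T'\in\mathcal F'[i]$, neither in a cherry of $\mathcal T'$, and either (i) $\mathcal F'[i+1]=\mathcal F'[i]$ and $\mathcal F[i+1]$ is $\mathcal F[i]-e_{x_i}$ or $\mathcal F[i]-e_y$, or (ii) for $e$ the edge of $\mathcal T'$ containing the vertex adjacent to $x_i$ and not on the path between $x_i$ and $y$, $\mathcal F'[i+1]=\mathcal F'[i]-e$ and $\mathcal F[i+1]=\mathcal F[i]$; (c) $x_i,y$ lie in different trees of $\mathcal F'[i]$, neither is an isolated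 vertex or in a cherry of $\mathcal F'[i]$, $\mathcal F'[i+1]=\mathcal F'[i]$, and $\mathcal F[i+1]$ is $\mathcal F[i]-e_{x_i}$ or $\mathcal F[i]-e_y$; or the same with the roles of $\mathcal F$ and $\mathcal F'$ reversed; (C3) $x_i$ is a single-vertex component of $\mathcal F[i]$, $\mathcal F[i+1]=\mathcal F[i]-x_i$ and $\mathcal F'[i+1]=\mathcal F'[i]-x_i$, or the same with the roles of $\mathcal F$ and $\mathcal F'$ reversed. Weight: if $m\ge2$, $c(x_i)=0$ if (C1) or (C3) applies at step $i$ and $c(x_i)=1$ otherwise, and $w(\sigma)=\sum_{i=1}^{m-1}c(x_i)$; if $m=1$, $w(\sigma)=0$. *)

theory Defs
  imports Main "HOL-Library.Infinite_Typeclass"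
begin

section \<open>Finite simple graphs\<close>

text \<open>
  Phylogenetic networks and trees are simple, and neither passing to a subtree nor suppressing
  degree-two vertices of an acyclic graph creates parallel edges, so an edge is represented by its
  two-element set of ends.
\<close>

record 'v ugraph =
  verts :: "'v set"
  edges :: "'v set set"

definition simple_graph :: "'v ugraph \<Rightarrow> bool" where
  "simple_graph G \<longleftrightarrow> finite (verts G) \<and> (\<forall>e\<in>edges G. e \<subseteq> verts G \<and> card e = 2)"

definition adj :: "'v ugraph \<Rightarrow> 'v \<Rightarrow> 'v \<Rightarrow> bool" where
  "adj G u v \<longleftrightarrow> {u, v} \<in> edges G"

definition incident :: "'v ugraph \<Rightarrow> 'v \<Rightarrow> 'v set set" where
  "incident G v = {e \<in> edges G. v \<in> e}"

definition degree :: "'v ugraph \<Rightarrow> 'v \<Rightarrow> nat" where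
  "degree G v = card (incident G v)"

definition leaves :: "'v ugraph \<Rightarrow> 'v set" where
  "leaves G = {v \<in> verts G. degree G v \<le> 1}"

definition is_connected :: "'v ugraph \<Rightarrow> bool" where
  "is_connected G \<longleftrightarrow> verts G \<noteq> {} \<and> (\<forall>u\<in>verts G. \<forall>v\<in>verts G. (adj G)\<^sup>*\<^sup>* u v)"

definition is_path :: "'v ugraph \<Rightarrow> 'v list \<Rightarrow> bool" where
  "is_path G vs \<longleftrightarrow> vs \<noteq> [] \<and> distinct vs \<and> set vs \<subseteq> verts G \<and> successively (adj G) vs"

definition path_edges :: "'v list \<Rightarrow> 'v set set" where
  "path_edges vs = {{vs ! i, vs ! Suc i} | i. Suc i < length vs}"

definition is_cycle :: "'v ugraph \<Rightarrow> 'v list \<Rightarrow> bool" where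
  "is_cycle G vs \<longleftrightarrow> is_path G vs \<and> length vs \<ge> 3 \<and> adj G (last vs) (hd vs)"

definition acyclic_graph :: "'v ugraph \<Rightarrow> bool" where
  "acyclic_graph G \<longleftrightarrow> (\<nexists>vs. is_cycle G vs)"

definition subgraph :: "'v ugraph \<Rightarrow> 'v ugraph \<Rightarrow> bool" where
  "subgraph H G \<longleftrightarrow> simple_graph H \<and> verts H \<subseteq> verts G \<and> edges H \<subseteq> edges G"

definition subtree :: "'v ugraph \<Rightarrow> 'v ugraph \<Rightarrow> bool" where
  "subtree H G \<longleftrightarrow> subgraph H G \<and> is_connected H \<and> acyclic_graph H"

definition induced :: "'v ugraph \<Rightarrow> 'v set \<Rightarrow> 'v ugraph" where
  "induced G W = \<lparr>verts = W, edges = {e \<in> edges G. e \<subseteq> W}\<rparr>"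

definition components :: "'v ugraph \<Rightarrow> 'v ugraph set" where
  "components G = {induced G {w \<in> verts G. (adj G)\<^sup>*\<^sup>* v w} | v. v \<in> verts G}"

definition delete_edge :: "'v ugraph \<Rightarrow> 'v set \<Rightarrow> 'v ugraph" where
  "delete_edge G e = \<lparr>verts = verts G, edges = edges G - {e}\<rparr>"

definition delete_vertex :: "'v ugraph \<Rightarrow> 'v \<Rightarrow> 'v ugraph" where
  "delete_vertex G v = \<lparr>verts = verts G - {v}, edges = edges G - incident G v\<rparr>"

definition cut_edge :: "'v ugraph \<Rightarrow> 'v set \<Rightarrow> bool" where
  "cut_edge G e \<longleftrightarrow> (\<exists>u v. e = {u, v} \<and> e \<in> edges G \<and> \<not> (adj (delete_edge G e))\<^sup>*\<^sup>* u v)"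

text \<open>Suppressing one degree-two vertex \<open>v\<close>, and suppressing all degree-two vertices.\<close>

definition suppress_step :: "'v ugraph \<Rightarrow> 'v ugraph \<Rightarrow> bool" where
  "suppress_step G H \<longleftrightarrow> (\<exists>u v w. v \<in> verts G \<and> u \<noteq> w \<and> incident G v = {{u, v}, {v, w}} \<and>
     H = \<lparr>verts = verts G - {v}, edges = (edges G - {{u, v}, {v, w}}) \<union> {{u, w}}\<rparr>)"

definition suppresses_to :: "'v ugraph \<Rightarrow> 'v ugraph \<Rightarrow> bool" where
  "suppresses_to G H \<longleftrightarrow> suppress_step\<^sup>*\<^sup>* G H \<and> (\<forall>v\<in>verts H. degree H v \<noteq> 2)"

definition iso_fixing :: "'v set \<Rightarrow> 'v ugraph \<Rightarrow> 'v ugraph \<Rightarrow> bool" where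
  "iso_fixing Y G H \<longleftrightarrow> Y \<subseteq> verts G \<and>
     (\<exists>f. bij_betw f (verts G) (verts H) \<and> edges H = (\<lambda>e. f ` e) ` edges G \<and> (\<forall>y\<in>Y. f y = y))"


section \<open>Phylogenetic networks, trees and forests\<close>

definition phylo_network :: "'v set \<Rightarrow> 'v ugraph \<Rightarrow> bool" where
  "phylo_network X N \<longleftrightarrow> finite X \<and> X \<noteq> {} \<and> simple_graph N \<and> is_connected N \<and>
     leaves N = X \<and> (\<forall>v \<in> verts N - leaves N. degree N v = 3)"

definition ret_number :: "'v ugraph \<Rightarrow> int" where
  "ret_number N = int (card (edges N)) - (int (card (verts N)) - 1)"

definition phylo_tree :: "'v set \<Rightarrow> 'v ugraph \<Rightarrow> bool" where
  "phylo_tree X T \<longleftrightarrow> phylo_network X T \<and> acyclic_graph T"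

text \<open>
  The trees of a forest are separate graphs: only their leaf sets have to be disjoint, and the
  names of interior vertices carry no information. Hence membership of an element of \<open>X\<close> in a tree
  is always expressed through \<^const>\<open>leaves\<close>.
\<close>

definition forest_on :: "'v set \<Rightarrow> 'v ugraph set \<Rightarrow> bool" where
  "forest_on X F \<longleftrightarrow> finite X \<and> X \<noteq> {} \<and> (\<forall>T\<in>F. \<exists>Y. phylo_tree Y T) \<and>
     (\<forall>T\<in>F. \<forall>T'\<in>F. T \<noteq> T' \<longrightarrow> leaves T \<inter> leaves T' = {}) \<and> (\<Union>T\<in>F. leaves T) = X"

text \<open>\<open>displayed_via N S T\<close>: the subtree \<open>S\<close> of \<open>N\<close> is a possible choice of \<open>N[T]\<close>.\<close>

definition displayed_via :: "'v ugraph \<Rightarrow> 'v ugraph \<Rightarrow> 'v ugraph \<Rightarrow> bool" where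
  "displayed_via N S T \<longleftrightarrow> subtree S N \<and> (\<exists>H. suppresses_to S H \<and> iso_fixing (leaves T) H T)"

definition displays_forest :: "'v ugraph \<Rightarrow> 'v ugraph set \<Rightarrow> bool" where
  "displays_forest N F \<longleftrightarrow> (\<exists>S. (\<forall>T\<in>F. displayed_via N (S T) T) \<and>
     (\<forall>T\<in>F. \<forall>T'\<in>F. T \<noteq> T' \<longrightarrow> verts (S T) \<inter> verts (S T') = {}))"

definition cherry :: "'v ugraph \<Rightarrow> 'v \<Rightarrow> 'v \<Rightarrow> bool" where
  "cherry T x y \<longleftrightarrow> x \<noteq> y \<and> x \<in> leaves T \<and> y \<in> leaves T \<and>
     (T = \<lparr>verts = {x, y}, edges = {{x, y}}\<rparr> \<or> (\<exists>v. adj T x v \<and> adj T y v))"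

definition forest_cherry :: "'v ugraph set \<Rightarrow> 'v \<Rightarrow> 'v \<Rightarrow> bool" where
  "forest_cherry F x y \<longleftrightarrow> (\<exists>T\<in>F. cherry T x y)"

text \<open>\<open>proper_pendant_subtree T e S\<close>: \<open>S\<close> is a proper pendant subtree of \<open>T\<close> with \<open>e = e\<^sub>S\<close>.\<close>

definition proper_pendant_subtree :: "'v ugraph \<Rightarrow> 'v set \<Rightarrow> 'v ugraph \<Rightarrow> bool" where
  "proper_pendant_subtree T e S \<longleftrightarrow> (\<exists>Y. phylo_tree Y S) \<and> cut_edge T e \<and>
     (\<exists>H. suppresses_to (delete_edge T e) H \<and> S \<in> components H)"

text \<open>
  The pendant subtrees \<open>((x,y),p)\<close>, \<open>((x,y),(p,q))\<close> and \<open>(p,q)\<close> of \<open>T\<close>. Suppression forgets where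
  \<open>S\<close> was attached to \<open>T\<close> (every pair of leaves of a three-leaf tree is a cherry, and the caterpillar
  \<open>(((x,y),p),q)\<close> also turns into the quartet with cherries \<open>(x,y)\<close> and \<open>(p,q)\<close>), so the pairs are
  required to be cherries of \<open>T\<close> as well.
\<close>

definition pendant3 :: "'v ugraph \<Rightarrow> 'v set \<Rightarrow> 'v \<Rightarrow> 'v \<Rightarrow> 'v \<Rightarrow> bool" where
  "pendant3 T e x y p \<longleftrightarrow> distinct [x, y, p] \<and>
     (\<exists>S. proper_pendant_subtree T e S \<and> leaves S = {x, y, p} \<and> cherry S x y \<and> cherry T x y)"

definition pendant4 :: "'v ugraph \<Rightarrow> 'v set \<Rightarrow> 'v \<Rightarrow> 'v \<Rightarrow> 'v \<Rightarrow> 'v \<Rightarrow> bool" where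
  "pendant4 T e x y p q \<longleftrightarrow> distinct [x, y, p, q] \<and>
     (\<exists>S. proper_pendant_subtree T e S \<and> leaves S = {x, y, p, q} \<and>
        cherry S x y \<and> cherry S p q \<and> cherry T x y \<and> cherry T p q)"

definition pendant2 :: "'v ugraph \<Rightarrow> 'v set \<Rightarrow> 'v \<Rightarrow> 'v \<Rightarrow> bool" where
  "pendant2 T e p q \<longleftrightarrow> p \<noteq> q \<and> (\<exists>S. proper_pendant_subtree T e S \<and> leaves S = {p, q})"

text \<open>
  The operations on forests are written as relations: \<open>minus_edge F T e G\<close> means \<open>G = F - e\<close> for
  the edge \<open>e\<close> of the tree \<open>T\<close> of \<open>F\<close>, \<open>minus_leaf_edge F x G\<close> means \<open>G = F - e\<^sub>x\<close>, and
  \<open>minus_leaf F x G\<close> means \<open>G = F - x\<close>.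
\<close>

definition minus_edge :: "'v ugraph set \<Rightarrow> 'v ugraph \<Rightarrow> 'v set \<Rightarrow> 'v ugraph set \<Rightarrow> bool" where
  "minus_edge F T e G \<longleftrightarrow> T \<in> F \<and> e \<in> edges T \<and>
     (\<exists>H. suppresses_to (delete_edge T e) H \<and> G = (F - {T}) \<union> components H)"

definition minus_leaf_edge :: "'v ugraph set \<Rightarrow> 'v \<Rightarrow> 'v ugraph set \<Rightarrow> bool" where
  "minus_leaf_edge F x G \<longleftrightarrow> (\<exists>T e. x \<in> leaves T \<and> x \<in> e \<and> minus_edge F T e G)"

definition minus_leaf :: "'v ugraph set \<Rightarrow> 'v \<Rightarrow> 'v ugraph set \<Rightarrow> bool" where
  "minus_leaf F x G \<longleftrightarrow> card (\<Union>T\<in>F. leaves T) \<ge> 2 \<and> (\<exists>T\<in>F. x \<in> leaves T \<and>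
     (if verts T = {x} then G = F - {T}
      else \<exists>H. suppresses_to (delete_vertex T x) H \<and> G = (F - {T}) \<union> {H}))"


section \<open>Cherry picking sequences\<close>

text \<open>
  \<open>C1 F F' x G G'\<close> etc.: the rule applies with \<open>x\<^sub>i = x\<close>, current forests \<open>F, F'\<close> and next
  forests \<open>G, G'\<close>. The predicates \<open>C2_half\<close> and \<open>C3_half\<close> are the versions before exchanging the
  roles of the two forests.
\<close>

definition C1 :: "'v ugraph set \<Rightarrow> 'v ugraph set \<Rightarrow> 'v \<Rightarrow> 'v ugraph set \<Rightarrow> 'v ugraph set \<Rightarrow> bool" where
  "C1 F F' x G G' \<longleftrightarrow>
     (\<exists>y. forest_cherry F x y \<and> forest_cherry F' x y) \<and> minus_leaf F x G \<and> minus_leaf F' x G'"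

definition C2a ::
  "'v ugraph set \<Rightarrow> 'v ugraph set \<Rightarrow> 'v \<Rightarrow> 'v \<Rightarrow> 'v ugraph set \<Rightarrow> 'v ugraph set \<Rightarrow> bool" where
  "C2a F F' x y G G' \<longleftrightarrow> (\<exists>z. z \<noteq> y \<and> forest_cherry F' x z) \<and> G' = F' \<and>
     ((minus_leaf_edge F x G \<or> minus_leaf_edge F y G) \<or>
      (\<exists>T\<in>F. \<exists>e p. pendant3 T e x y p \<and> (minus_leaf_edge F p G \<or> minus_edge F T e G)) \<or>
      (\<exists>T\<in>F. \<exists>e p q. pendant4 T e x y p q \<and>
         (minus_leaf_edge F p G \<or> minus_leaf_edge F q G \<or>
          (\<exists>e'. pendant2 T e' p q \<and> minus_edge F T e' G))))"

definition C2b ::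
  "'v ugraph set \<Rightarrow> 'v ugraph set \<Rightarrow> 'v \<Rightarrow> 'v \<Rightarrow> 'v ugraph set \<Rightarrow> 'v ugraph set \<Rightarrow> bool" where
  "C2b F F' x y G G' \<longleftrightarrow> (\<exists>T'\<in>F'. x \<in> leaves T' \<and> y \<in> leaves T' \<and>
     (\<nexists>z. cherry T' x z) \<and> (\<nexists>z. cherry T' y z) \<and>
     ((G' = F' \<and> (minus_leaf_edge F x G \<or> minus_leaf_edge F y G)) \<or>
      (G = F \<and> (\<exists>v e vs. adj T' x v \<and> v \<in> e \<and> e \<in> edges T' \<and>
         is_path T' vs \<and> hd vs = x \<and> last vs = y \<and> e \<notin> path_edges vs \<and> minus_edge F' T' e G'))))"

definition C2c ::
  "'v ugraph set \<Rightarrow> 'v ugraph set \<Rightarrow> 'v \<Rightarrow> 'v \<Rightarrow> 'v ugraph set \<Rightarrow> 'v ugraph set \<Rightarrow> bool" where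
  "C2c F F' x y G G' \<longleftrightarrow>
     (\<exists>T1\<in>F'. \<exists>T2\<in>F'. T1 \<noteq> T2 \<and> x \<in> leaves T1 \<and> y \<in> leaves T2 \<and>
        verts T1 \<noteq> {x} \<and> verts T2 \<noteq> {y}) \<and>
     (\<nexists>z. forest_cherry F' x z) \<and> (\<nexists>z. forest_cherry F' y z) \<and>
     G' = F' \<and> (minus_leaf_edge F x G \<or> minus_leaf_edge F y G)"

definition C2_half ::
  "'v ugraph set \<Rightarrow> 'v ugraph set \<Rightarrow> 'v \<Rightarrow> 'v ugraph set \<Rightarrow> 'v ugraph set \<Rightarrow> bool" where
  "C2_half F F' x G G' \<longleftrightarrow> (\<exists>y. forest_cherry F x y \<and>
     (C2a F F' x y G G' \<or> C2b F F' x y G G' \<or> C2c F F' x y G G'))"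

definition C2 :: "'v ugraph set \<Rightarrow> 'v ugraph set \<Rightarrow> 'v \<Rightarrow> 'v ugraph set \<Rightarrow> 'v ugraph set \<Rightarrow> bool" where
  "C2 F F' x G G' \<longleftrightarrow> C2_half F F' x G G' \<or> C2_half F' F x G' G"

definition C3_half ::
  "'v ugraph set \<Rightarrow> 'v ugraph set \<Rightarrow> 'v \<Rightarrow> 'v ugraph set \<Rightarrow> 'v ugraph set \<Rightarrow> bool" where
  "C3_half F F' x G G' \<longleftrightarrow> (\<exists>T\<in>F. verts T = {x}) \<and> minus_leaf F x G \<and> minus_leaf F' x G'"

definition C3 :: "'v ugraph set \<Rightarrow> 'v ugraph set \<Rightarrow> 'v \<Rightarrow> 'v ugraph set \<Rightarrow> 'v ugraph set \<Rightarrow> bool" where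
  "C3 F F' x G G' \<longleftrightarrow> C3_half F F' x G G' \<or> C3_half F' F x G' G"

definition picking_step ::
  "'v ugraph set \<Rightarrow> 'v ugraph set \<Rightarrow> 'v \<Rightarrow> 'v ugraph set \<Rightarrow> 'v ugraph set \<Rightarrow> bool" where
  "picking_step F F' x G G' \<longleftrightarrow>
     (C1 F F' x G G' \<and> \<not> C2 F F' x G G' \<and> \<not> C3 F F' x G G') \<or>
     (\<not> C1 F F' x G G' \<and> C2 F F' x G G' \<and> \<not> C3 F F' x G G') \<or>
     (\<not> C1 F F' x G G' \<and> \<not> C2 F F' x G G' \<and> C3 F F' x G G')"

text \<open>
  The forests \<open>F[i]\<close>, \<open>F'[i]\<close> witnessing that \<open>\<sigma>\<close> is a cherry picking sequence are parameters,
  because the weight of \<open>\<sigma>\<close> refers to them. Indices are shifted by one: \<open>\<sigma> ! i\<close>, \<open>\<Phi> i\<close>, \<open>\<Phi>' i\<close>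
  stand for \<open>x\<^sub>i\<^sub>+\<^sub>1\<close>, \<open>F[i+1]\<close>, \<open>F'[i+1]\<close>.
\<close>

definition cherry_picking_sequence ::
  "'v set \<Rightarrow> 'v ugraph set \<Rightarrow> 'v ugraph set \<Rightarrow> 'v list \<Rightarrow>
   (nat \<Rightarrow> 'v ugraph set) \<Rightarrow> (nat \<Rightarrow> 'v ugraph set) \<Rightarrow> bool" where
  "cherry_picking_sequence X F F' \<sigma> \<Phi> \<Phi>' \<longleftrightarrow>
     set \<sigma> \<subseteq> X \<and> length \<sigma> \<ge> card X \<and> card X \<ge> 1 \<and>
     (\<forall>i < length \<sigma>. (\<exists>Y. forest_on Y (\<Phi> i)) \<and> (\<exists>Y. forest_on Y (\<Phi>' i))) \<and>
     \<Phi> 0 = F \<and> \<Phi>' 0 = F' \<and>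
     \<Phi> (length \<sigma> - 1) = {\<lparr>verts = {last \<sigma>}, edges = {}\<rparr>} \<and>
     \<Phi>' (length \<sigma> - 1) = {\<lparr>verts = {last \<sigma>}, edges = {}\<rparr>} \<and>
     (\<forall>i < length \<sigma> - 1. picking_step (\<Phi> i) (\<Phi>' i) (\<sigma> ! i) (\<Phi> (Suc i)) (\<Phi>' (Suc i)))"

definition weight :: "'v list \<Rightarrow> (nat \<Rightarrow> 'v ugraph set) \<Rightarrow> (nat \<Rightarrow> 'v ugraph set) \<Rightarrow> nat" where
  "weight \<sigma> \<Phi> \<Phi>' = (\<Sum>i < length \<sigma> - 1.
     if C1 (\<Phi> i) (\<Phi>' i) (\<sigma> ! i) (\<Phi> (Suc i)) (\<Phi>' (Suc i)) \<or>
        C3 (\<Phi> i) (\<Phi>' i) (\<sigma> ! i) (\<Phi> (Suc i)) (\<Phi>' (Suc i)) then 0 else 1)"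

end

theory Submission
  imports Defs
begin

text \<open>
  The network is built backwards along the sequence, starting from the single vertex of the last
  forests. To undo the deletion of an edge of a tree (C2), take the embeddings of its two halves,
  subdivide in each the edge of the network at which the deleted edge has to be attached, and join
  the two new vertices; this costs one reticulation, and subdividing edges of the network does not
  disturb the embeddings of the other trees. To undo the removal of a leaf \<open>x\<close> (C1, C3),
  subdivide one edge of the network and attach \<open>x\<close> to the new vertex, which costs nothing. The same
  edge has to serve both forests: in case C3 one of them imposes no condition, and in case C1 both
  admit the edge at the other leaf \<open>y\<close> of the common cherry.

  Which subcase of C2 applies is irrelevant. In acyclic graphs suppressing a vertex is inverse to
  subdividing an edge, and all embeddings are handled by means of subdivisions.
\<close>

section \<open>Graphs and bridges\<close>

lemma ugraph_eqI: "verts G = verts H \<Longrightarrow> edges G = edges H \<Longrightarrow> G = (H :: 'v ugraph)"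
  by (rule ugraph.equality) auto

lemma rtranclp_hom:
  assumes "r\<^sup>*\<^sup>* a b" and "\<And>x y. r x y \<Longrightarrow> s\<^sup>*\<^sup>* (f x) (f y)"
  shows "s\<^sup>*\<^sup>* (f a) (f b)"
  using assms(1) by (induction) (auto intro: rtranclp_trans assms(2))

lemma rtranclp_weaken:
  assumes "r\<^sup>*\<^sup>* a b" and "\<And>x y. r x y \<Longrightarrow> s x y"
  shows "s\<^sup>*\<^sup>* a b"
  using rtranclp_hom[OF assms(1), of s "\<lambda>x. x"] assms(2) by auto

lemma rtranclp_2_steps: "r a b \<Longrightarrow> r b c \<Longrightarrow> r\<^sup>*\<^sup>* a c"
  by auto

lemma adj_commute: "adj G u v \<longleftrightarrow> adj G v u"
  by (simp add: adj_def insert_commute)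

lemma adj_rtranclp_sym: "(adj G)\<^sup>*\<^sup>* u v \<Longrightarrow> (adj G)\<^sup>*\<^sup>* v u"
  by (induction rule: rtranclp_induct) (auto intro: converse_rtranclp_into_rtranclp adj_commute[THEN iffD1])

lemma simple_graph_finite_edges: "simple_graph G \<Longrightarrow> finite (edges G)"
  by (rule finite_subset[of _ "Pow (verts G)"]) (auto simp: simple_graph_def)

lemma simple_graph_edgeD:
  assumes "simple_graph G" and "{u, v} \<in> edges G"
  shows "u \<in> verts G" "v \<in> verts G" "u \<noteq> v"
  using assms by (auto simp: simple_graph_def dest!: bspec)

lemma simple_graph_edgeE:
  assumes "simple_graph G" and "e \<in> edges G"
  obtains u v where "e = {u, v}" "u \<noteq> v" "u \<in> verts G" "v \<in> verts G"
  using assms by (fastforce simp: simple_graph_def card_2_iff)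

lemma simple_graph_edge_atE:
  assumes "simple_graph G" and "e \<in> edges G" and "u \<in> e"
  obtains v where "e = {u, v}" "u \<noteq> v" "u \<in> verts G" "v \<in> verts G"
proof -
  obtain a b where "e = {a, b}" "a \<noteq> b" "a \<in> verts G" "b \<in> verts G"
    using simple_graph_edgeE[OF assms(1,2)] .
  then show thesis using that[of a] that[of b] assms(3) by (auto simp: insert_commute)
qed

lemma simple_graph_adjD:
  assumes "simple_graph G" and "adj G u v"
  shows "u \<in> verts G" "v \<in> verts G" "u \<noteq> v"
  using assms simple_graph_edgeD[of G u v] by (auto simp: adj_def)

lemma is_connectedI:
  assumes "r \<in> verts G" and "\<And>v. v \<in> verts G \<Longrightarrow> (adj G)\<^sup>*\<^sup>* r v"
  shows "is_connected G"
  unfolding is_connected_def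
  using assms by (metis adj_rtranclp_sym empty_iff rtranclp_trans)

lemma is_connectedD:
  assumes "is_connected G" and "u \<in> verts G" and "v \<in> verts G"
  shows "(adj G)\<^sup>*\<^sup>* u v"
  using assms by (auto simp: is_connected_def)

lemma connected_incident_nonempty:
  assumes "is_connected G" and "u \<in> verts G" and "v \<in> verts G" and "u \<noteq> v"
  shows "\<exists>e\<in>edges G. u \<in> e"
  using converse_rtranclpE[OF is_connectedD[OF assms(1-3)]] assms(4)
  by (metis adj_def insertI1)

lemma path_of_adj_rtranclp:
  assumes "simple_graph G" and "(adj G)\<^sup>*\<^sup>* u v" and "u \<in> verts G"
  shows "\<exists>vs. is_path G vs \<and> hd vs = u \<and> last vs = v"
  using assms(2,3)
proof (induction rule: rtranclp_induct)
  case base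
  then show ?case by (intro exI[of _ "[u]"]) (auto simp: is_path_def)
next
  case (step y z)
  then obtain vs where vs: "is_path G vs" "hd vs = u" "last vs = y" by auto
  show ?case
  proof (cases "z \<in> set vs")
    case True
    then obtain xs ys where vs_eq: "vs = xs @ z # ys" by (meson split_list)
    have "is_path G (xs @ [z])"
      using vs(1) unfolding is_path_def vs_eq by (auto simp: successively_append_iff)
    moreover have "hd (xs @ [z]) = u" using vs(2) unfolding vs_eq by (cases xs) auto
    ultimately show ?thesis by (metis last_snoc)
  next
    case False
    have "is_path G (vs @ [z])"
      using vs False step(2) simple_graph_adjD[OF assms(1) step(2)]
      unfolding is_path_def by (auto simp: successively_append_iff)
    moreover have "hd (vs @ [z]) = u" using vs by (auto simp: is_path_def)
    ultimately show ?thesis by (metis last_snoc)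
  qed
qed

lemma successively_rtranclp: "successively r vs \<Longrightarrow> vs \<noteq> [] \<Longrightarrow> r\<^sup>*\<^sup>* (hd vs) (last vs)"
  by (induction vs rule: induct_list012) (auto intro: converse_rtranclp_into_rtranclp)

lemma delete_edge_simps [simp]:
  "verts (delete_edge G e) = verts G" "edges (delete_edge G e) = edges G - {e}"
  by (simp_all add: delete_edge_def)

lemma adj_delete_edge: "adj (delete_edge G e) u v \<longleftrightarrow> adj G u v \<and> {u, v} \<noteq> e"
  by (auto simp: adj_def delete_edge_def)

lemma acyclic_graph_iff_bridges:
  assumes "simple_graph G"
  shows "acyclic_graph G \<longleftrightarrow> (\<forall>u v. {u, v} \<in> edges G \<longrightarrow> \<not> (adj (delete_edge G {u, v}))\<^sup>*\<^sup>* u v)"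
proof (intro iffI allI impI notI)
  fix u v assume ac: "acyclic_graph G" and e: "{u, v} \<in> edges G"
    and r: "(adj (delete_edge G {u, v}))\<^sup>*\<^sup>* u v"
  have "simple_graph (delete_edge G {u, v})"
    using assms by (auto simp: simple_graph_def delete_edge_def)
  then obtain vs where vs: "is_path (delete_edge G {u, v}) vs" "hd vs = u" "last vs = v"
    using path_of_adj_rtranclp[OF _ r] simple_graph_edgeD(1)[OF assms e]
    by (auto simp: delete_edge_def)
  have "u \<noteq> v" using simple_graph_edgeD[OF assms e] by auto
  have "length vs \<noteq> 0" "length vs \<noteq> 1"
    using vs \<open>u \<noteq> v\<close> by (auto simp: is_path_def length_Suc_conv)
  moreover have "length vs \<noteq> 2"
  proof
    assume "length vs = 2"
    then have "vs = [u, v]" using vs by (auto simp: numeral_2_eq_2 length_Suc_conv)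
    then show False using vs(1) by (auto simp: is_path_def adj_delete_edge)
  qed
  ultimately have "length vs \<ge> 3" by linarith
  moreover have "is_path G vs" using vs(1) unfolding is_path_def
    by (auto simp: delete_edge_def successively_conv_nth adj_def)
  moreover have "adj G (last vs) (hd vs)" using vs e by (simp add: adj_def insert_commute)
  ultimately show False using ac by (auto simp: acyclic_graph_def is_cycle_def)
next
  assume br: "\<forall>u v. {u, v} \<in> edges G \<longrightarrow> \<not> (adj (delete_edge G {u, v}))\<^sup>*\<^sup>* u v"
  show "acyclic_graph G" unfolding acyclic_graph_def
  proof
    assume "\<exists>vs. is_cycle G vs"
    then obtain vs where p: "is_path G vs" and l: "length vs \<ge> 3" and a: "adj G (last vs) (hd vs)"
      by (auto simp: is_cycle_def)
    have d: "distinct vs" and ne: "vs \<noteq> []" and s: "successively (adj G) vs"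
      using p by (auto simp: is_path_def)
    have "{vs ! i, vs ! Suc i} \<noteq> {hd vs, last vs}" if "Suc i < length vs" for i
    proof
      assume eq: "{vs ! i, vs ! Suc i} = {hd vs, last vs}"
      have "hd vs = vs ! 0" "last vs = vs ! (length vs - 1)"
        using ne by (auto simp: hd_conv_nth last_conv_nth)
      then have "(i = 0 \<or> Suc i = 0) \<and> (i = length vs - 1 \<or> Suc i = length vs - 1)"
        using eq that d ne l nth_eq_iff_index_eq[OF d] 
        by (metis (no_types, lifting) Suc_lessD diff_less doubleton_eq_iff length_greater_0_conv zero_less_one)
      then show False using l that by auto
    qed
    then have "successively (adj (delete_edge G {hd vs, last vs})) vs"
      using s by (auto simp: successively_conv_nth adj_delete_edge)
    then have "(adj (delete_edge G {hd vs, last vs}))\<^sup>*\<^sup>* (hd vs) (last vs)"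
      using ne by (rule successively_rtranclp)
    moreover have "{hd vs, last vs} \<in> edges G" using a by (simp add: adj_def insert_commute)
    ultimately show False using br by blast
  qed
qed

lemma acyclic_graph_bridge:
  assumes "simple_graph G" and "acyclic_graph G" and "{u, v} \<in> edges G"
  shows "\<not> (adj (delete_edge G {u, v}))\<^sup>*\<^sup>* u v"
  using assms acyclic_graph_iff_bridges by blast

lemma acyclic_graph_mono:
  assumes "acyclic_graph G" and "verts H \<subseteq> verts G" and "edges H \<subseteq> edges G"
  shows "acyclic_graph H"
  using assms unfolding acyclic_graph_def is_cycle_def is_path_def successively_conv_nth adj_def
  by blast

section \<open>Subdividing an edge\<close>

definition subdivide :: "'v set \<Rightarrow> 'v \<Rightarrow> 'v ugraph \<Rightarrow> 'v ugraph" where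
  "subdivide e n G = (if e \<in> edges G
     then \<lparr>verts = insert n (verts G), edges = edges G - {e} \<union> (\<lambda>z. {z, n}) ` e\<rparr> else G)"

lemma subdivide_id: "e \<notin> edges G \<Longrightarrow> subdivide e n G = G"
  by (simp add: subdivide_def)

lemma verts_subdivide: "e \<in> edges G \<Longrightarrow> verts (subdivide e n G) = insert n (verts G)"
  by (simp add: subdivide_def)

lemma edges_subdivide:
  "{p, q} \<in> edges G \<Longrightarrow> edges (subdivide {p, q} n G) = edges G - {{p, q}} \<union> {{p, n}, {q, n}}"
  by (simp add: subdivide_def insert_commute)

lemma verts_subdivide_subset: "verts (subdivide e n G) \<subseteq> insert n (verts G)"
  by (auto simp: subdivide_def)

lemma simple_graph_subdivide:
  assumes "simple_graph G" and "n \<notin> verts G"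
  shows "simple_graph (subdivide e n G)"
proof (cases "e \<in> edges G")
  case True
  then have "e \<subseteq> verts G" using assms by (auto simp: simple_graph_def)
  then have "\<forall>z\<in>e. card {z, n} = 2" using assms(2) by (metis card_2_iff subsetD)
  then show ?thesis using assms True \<open>e \<subseteq> verts G\<close> by (auto simp: simple_graph_def subdivide_def)
qed (simp add: subdivide_id assms)

lemma degree_subdivide:
  assumes "simple_graph G" and "n \<notin> verts G" and "e \<in> edges G"
  shows "degree (subdivide e n G) v = (if v = n then 2 else degree G v)"
proof -
  obtain p q where e: "e = {p, q}" "p \<noteq> q" "p \<in> verts G" "q \<in> verts G"
    using simple_graph_edgeE[OF assms(1,3)] .
  have pq: "{p, q} \<in> edges G" using assms e by simp
  have npq: "n \<noteq> p" "n \<noteq> q" using e assms by auto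
  have nn: "{p, n} \<notin> edges G" "{q, n} \<notin> edges G" "\<And>f. f \<in> edges G \<Longrightarrow> n \<notin> f"
    using assms by (auto simp: simple_graph_def)
  note fin = simple_graph_finite_edges[OF assms(1)]
  consider "v = n" | "v = p" | "v = q" | "v \<noteq> n" "v \<noteq> p" "v \<noteq> q" by blast
  then show ?thesis
  proof cases
    case 1
    have "incident (subdivide e n G) n = {{p, n}, {q, n}}"
      using nn npq unfolding incident_def e edges_subdivide[OF pq] by auto
    then show ?thesis using 1 e npq by (auto simp: degree_def doubleton_eq_iff)
  next
    case 2
    have "incident (subdivide e n G) p = insert {p, n} (incident G p - {{p, q}})"
      using nn npq e(2) unfolding incident_def e edges_subdivide[OF pq] by auto
    moreover have "{p, n} \<notin> incident G p" "{p, q} \<in> incident G p" "finite (incident G p)"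
      using nn pq fin by (auto simp: incident_def)
    ultimately show ?thesis using 2 npq
      by (simp add: degree_def card_Suc_Diff1 del: card_Diff_insert)
  next
    case 3
    have "incident (subdivide e n G) q = insert {q, n} (incident G q - {{p, q}})"
      using nn npq e(2) unfolding incident_def e edges_subdivide[OF pq] by auto
    moreover have "{q, n} \<notin> incident G q" "{p, q} \<in> incident G q" "finite (incident G q)"
      using nn pq fin by (auto simp: incident_def)
    ultimately show ?thesis using 3 npq
      by (simp add: degree_def card_Suc_Diff1 del: card_Diff_insert)
  next
    case 4
    have "incident (subdivide e n G) v = incident G v"
      using 4 unfolding incident_def e edges_subdivide[OF pq] by auto
    then show ?thesis using 4 by (simp add: degree_def)
  qed
qed

lemma card_subdivide:
  assumes "simple_graph G" and "n \<notin> verts G" and "e \<in> edges G"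
  shows "card (verts (subdivide e n G)) = Suc (card (verts G))"
    and "card (edges (subdivide e n G)) = Suc (card (edges G))"
proof -
  show "card (verts (subdivide e n G)) = Suc (card (verts G))"
    using assms by (simp add: verts_subdivide simple_graph_def)
  obtain p q where e: "e = {p, q}" "p \<noteq> q" "p \<in> verts G" "q \<in> verts G"
    using simple_graph_edgeE[OF assms(1,3)] .
  have pq: "{p, q} \<in> edges G" using assms e by simp
  have nn: "{p, n} \<notin> edges G" "{q, n} \<notin> edges G" "{p, n} \<noteq> {q, n}"
    using assms e by (auto simp: simple_graph_def doubleton_eq_iff)
  have "edges (subdivide e n G) = insert {p, n} (insert {q, n} (edges G - {{p, q}}))"
    unfolding e edges_subdivide[OF pq] by auto
  then show "card (edges (subdivide e n G)) = Suc (card (edges G))"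
    using nn pq simple_graph_finite_edges[OF assms(1)]
    by (simp add: card_Suc_Diff1 del: card_Diff_insert)
qed

lemma is_connected_subdivide:
  assumes "simple_graph G" and "n \<notin> verts G" and "is_connected G"
  shows "is_connected (subdivide e n G)"
proof (cases "e \<in> edges G")
  case True
  obtain p q where e: "e = {p, q}" "p \<noteq> q" "p \<in> verts G" "q \<in> verts G"
    using simple_graph_edgeE[OF assms(1) True] .
  let ?S = "subdivide e n G"
  have pq: "{p, q} \<in> edges G" using True e by simp
  have pn: "adj ?S p n" "adj ?S n q" "adj ?S q n" "adj ?S n p"
    unfolding adj_def e edges_subdivide[OF pq] by (auto simp: insert_commute)
  have *: "(adj ?S)\<^sup>*\<^sup>* x y" if "adj G x y" for x y
  proof (cases "{x, y} = {p, q}")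
    case True
    then have "x = p \<and> y = q \<or> x = q \<and> y = p" by (auto simp: doubleton_eq_iff)
    then show ?thesis using pn by (elim disjE) (auto intro: rtranclp_2_steps[where b = n])
  next
    case False
    then have "adj ?S x y" using that unfolding adj_def e edges_subdivide[OF pq] by auto
    then show ?thesis by blast
  qed
  show ?thesis
  proof (rule is_connectedI[of p])
    show "p \<in> verts ?S" using True e by (simp add: verts_subdivide)
    fix v assume "v \<in> verts ?S"
    then consider "v = n" | "v \<in> verts G" using True by (auto simp: verts_subdivide)
    then show "(adj ?S)\<^sup>*\<^sup>* p v"
    proof cases
      case 1 then show ?thesis using pn by auto
    next
      case 2
      then have "(adj G)\<^sup>*\<^sup>* p v" using is_connectedD[OF assms(3)] e by auto
      then show ?thesis using rtranclp_hom[of "adj G" p v "adj ?S" id] * by auto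
    qed
  qed
qed (simp add: subdivide_id assms)

lemma acyclic_graph_subdivide_iff:
  assumes "simple_graph G" and "n \<notin> verts G"
  shows "acyclic_graph (subdivide e n G) \<longleftrightarrow> acyclic_graph G"
proof (cases "e \<in> edges G")
  case True
  obtain p q where e: "e = {p, q}" "p \<noteq> q" "p \<in> verts G" "q \<in> verts G"
    using simple_graph_edgeE[OF assms(1) True] .
  let ?S = "subdivide e n G"
  have pq: "{p, q} \<in> edges G" using True e by simp
  have npq: "n \<noteq> p" "n \<noteq> q" using e assms by auto
  have nn: "\<And>f. f \<in> edges G \<Longrightarrow> n \<notin> f"
    using assms by (auto simp: simple_graph_def)
  have edgesS: "edges ?S = edges G - {{p, q}} \<union> {{p, n}, {q, n}}"
    unfolding e using edges_subdivide[OF pq] by simp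
  have simpleS: "simple_graph ?S" by (rule simple_graph_subdivide[OF assms])
  show ?thesis
  proof
    assume ac: "acyclic_graph ?S"
    show "acyclic_graph G" unfolding acyclic_graph_iff_bridges[OF assms(1)]
    proof (intro allI impI notI)
      fix x y assume xy: "{x, y} \<in> edges G" and r: "(adj (delete_edge G {x, y}))\<^sup>*\<^sup>* x y"
      show False
      proof (cases "{x, y} = {p, q}")
        case True
        have "(adj (delete_edge ?S {x, n}))\<^sup>*\<^sup>* x y"
        proof (rule rtranclp_weaken[OF r])
          fix a b assume "adj (delete_edge G {x, y}) a b"
          then have "{a, b} \<in> edges G" "{a, b} \<noteq> {p, q}"
            using True by (simp_all add: adj_def)
          moreover from this have "{a, b} \<noteq> {x, n}" using nn by blast
          ultimately show "adj (delete_edge ?S {x, n}) a b"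
            by (simp add: adj_def edgesS)
        qed
        moreover have "adj (delete_edge ?S {x, n}) y n"
          using True e(2) npq by (auto simp: adj_def edgesS doubleton_eq_iff)
        ultimately have "(adj (delete_edge ?S {x, n}))\<^sup>*\<^sup>* x n" by auto
        moreover have "{x, n} \<in> edges ?S" using True by (auto simp: edgesS doubleton_eq_iff)
        ultimately show False using acyclic_graph_bridge[OF simpleS ac] by blast
      next
        case False
        have xyn: "n \<noteq> x" "n \<noteq> y" using nn[OF xy] by auto
        let ?r = "adj (delete_edge ?S {x, y})"
        have pn: "?r p n" "?r n q" "?r q n" "?r n p"
          using xyn by (auto simp: adj_def edgesS doubleton_eq_iff insert_commute)
        have "?r\<^sup>*\<^sup>* a b" if ab: "adj (delete_edge G {x, y}) a b" for a b
        proof (cases "{a, b} = {p, q}")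
          case True
          then have "a = p \<and> b = q \<or> a = q \<and> b = p" by (auto simp: doubleton_eq_iff)
          then show ?thesis using pn by (elim disjE) (auto intro: rtranclp_2_steps[where b = n])
        next
          case False
          then have "?r a b" using ab by (auto simp: adj_def edgesS)
          then show ?thesis by blast
        qed
        then have "?r\<^sup>*\<^sup>* x y" using rtranclp_hom[OF r, of ?r id] by auto
        moreover have "{x, y} \<in> edges ?S" using xy False by (auto simp: edgesS)
        ultimately show False using acyclic_graph_bridge[OF simpleS ac] by blast
      qed
    qed
  next
    assume ac: "acyclic_graph G"
    have half: False if pq': "{p', q'} = {p, q}" and r: "(adj (delete_edge ?S {p', n}))\<^sup>*\<^sup>* p' n"
      for p' q'
    proof -
      let ?f = "\<lambda>z. if z = n then q' else z"
      have "p' \<noteq> n" using pq' npq by (auto simp: doubleton_eq_iff)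
      have "(adj (delete_edge G {p', q'}))\<^sup>*\<^sup>* (?f p') (?f n)"
      proof (rule rtranclp_hom[OF r])
        fix a b assume ab: "adj (delete_edge ?S {p', n}) a b"
        have "adj (delete_edge G {p', q'}) a b \<or> {a, b} = {q', n}"
          using ab pq' by (auto simp: adj_def edgesS doubleton_eq_iff)
        then show "(adj (delete_edge G {p', q'}))\<^sup>*\<^sup>* (?f a) (?f b)"
        proof
          assume "adj (delete_edge G {p', q'}) a b"
          moreover from this have "a \<noteq> n" "b \<noteq> n" using nn by (auto simp: adj_def)
          ultimately show ?thesis by auto
        qed (auto simp: doubleton_eq_iff)
      qed
      then show False using acyclic_graph_bridge[OF assms(1) ac, of p' q'] pq pq' \<open>p' \<noteq> n\<close> by auto
    qed
    show "acyclic_graph ?S" unfolding acyclic_graph_iff_bridges[OF simpleS]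
    proof (intro allI impI notI)
      fix x y assume xy: "{x, y} \<in> edges ?S" and r: "(adj (delete_edge ?S {x, y}))\<^sup>*\<^sup>* x y"
      consider "{x, y} = {p, n}" | "{x, y} = {q, n}" | "{x, y} \<in> edges G" "{x, y} \<noteq> {p, q}"
        using xy by (auto simp: edgesS)
      then show False
      proof cases
        case 1
        then have "(adj (delete_edge ?S {p, n}))\<^sup>*\<^sup>* p n"
          using doubleton_eq_iff[THEN iffD1, OF 1] r adj_rtranclp_sym[OF r] unfolding 1 by auto
        then show False using half[of p q] by auto
      next
        case 2
        then have "(adj (delete_edge ?S {q, n}))\<^sup>*\<^sup>* q n"
          using doubleton_eq_iff[THEN iffD1, OF 2] r adj_rtranclp_sym[OF r] unfolding 2 by auto
        then show False using half[of q p] by auto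
      next
        case 3
        let ?f = "\<lambda>z. if z = n then p else z"
        have "(adj (delete_edge G {x, y}))\<^sup>*\<^sup>* (?f x) (?f y)"
        proof (rule rtranclp_hom[OF r])
          fix a b assume ab: "adj (delete_edge ?S {x, y}) a b"
          have "{a, b} \<in> edges G \<and> {a, b} \<noteq> {x, y} \<or> {a, b} = {p, n} \<or> {a, b} = {q, n}"
            using ab by (auto simp: adj_def edgesS)
          then show "(adj (delete_edge G {x, y}))\<^sup>*\<^sup>* (?f a) (?f b)"
          proof (elim disjE)
            assume *: "{a, b} \<in> edges G \<and> {a, b} \<noteq> {x, y}"
            then have "a \<noteq> n" "b \<noteq> n" using nn by auto
            moreover have "adj (delete_edge G {x, y}) a b" using * by (simp add: adj_def)
            ultimately show ?thesis by auto
          next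
            assume "{a, b} = {q, n}"
            moreover have "adj (delete_edge G {x, y}) p q" "adj (delete_edge G {x, y}) q p"
              using pq 3 by (auto simp: adj_def insert_commute)
            ultimately show ?thesis using npq by (auto simp: doubleton_eq_iff)
          qed (use npq in \<open>auto simp: doubleton_eq_iff\<close>)
        qed
        moreover have "x \<noteq> n" "y \<noteq> n" using 3 nn by auto
        ultimately show False using acyclic_graph_bridge[OF assms(1) ac] 3 by auto
      qed
    qed
  qed
qed (simp add: subdivide_id)

lemma subdivide_commute:
  assumes "simple_graph G" and "e \<noteq> f" and "n \<notin> verts G" and "m \<notin> verts G"
    and "e \<in> edges G" and "f \<in> edges G"
  shows "subdivide e n (subdivide f m G) = subdivide f m (subdivide e n G)"
proof -
  have nn: "\<And>h. h \<in> edges G \<Longrightarrow> n \<notin> h \<and> m \<notin> h" using assms by (auto simp: simple_graph_def)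
  have "f \<noteq> {z, n}" "e \<noteq> {z, m}" for z using assms nn by blast+
  then show ?thesis using assms by (intro ugraph_eqI) (auto simp: subdivide_def)
qed

section \<open>Joining two graphs by an edge\<close>

definition point :: "'v \<Rightarrow> 'v ugraph" where
  "point x = \<lparr>verts = {x}, edges = {}\<rparr>"

definition join :: "'v ugraph \<Rightarrow> 'v ugraph \<Rightarrow> 'v \<Rightarrow> 'v \<Rightarrow> 'v ugraph" where
  "join G H a b = \<lparr>verts = verts G \<union> verts H, edges = insert {a, b} (edges G \<union> edges H)\<rparr>"

definition disjoint_sum :: "'v ugraph \<Rightarrow> 'v ugraph \<Rightarrow> 'v ugraph" where
  "disjoint_sum G H = \<lparr>verts = verts G \<union> verts H, edges = edges G \<union> edges H\<rparr>"

lemma point_simps [simp]: "verts (point x) = {x}" "edges (point x) = {}"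
  by (simp_all add: point_def)

lemma join_simps [simp]:
  "verts (join G H a b) = verts G \<union> verts H"
  "edges (join G H a b) = insert {a, b} (edges G \<union> edges H)"
  by (simp_all add: join_def)

lemma disjoint_sum_simps [simp]:
  "verts (disjoint_sum G H) = verts G \<union> verts H"
  "edges (disjoint_sum G H) = edges G \<union> edges H"
  by (simp_all add: disjoint_sum_def)

lemma simple_graph_point [simp]: "simple_graph (point x)"
  by (simp add: simple_graph_def)

lemma is_connected_point [simp]: "is_connected (point x)"
  by (auto simp: is_connected_def)

lemma acyclic_graph_point [simp]: "acyclic_graph (point x)"
  by (simp add: acyclic_graph_iff_bridges)

lemma degree_point [simp]: "degree (point x) v = 0"
  by (simp add: degree_def incident_def)

lemma leaves_point [simp]: "leaves (point x) = {x}"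
  by (auto simp: leaves_def)

lemma join_commute: "join G H a b = join H G b a"
  by (rule ugraph_eqI) auto

lemma simple_graph_join:
  assumes "simple_graph G" and "simple_graph H" and "a \<in> verts G \<union> verts H"
    and "b \<in> verts G \<union> verts H" and "a \<noteq> b"
  shows "simple_graph (join G H a b)"
  using assms by (auto simp: simple_graph_def)

lemma is_connected_join:
  assumes "is_connected G" and "is_connected H" and "a \<in> verts G" and "b \<in> verts H"
  shows "is_connected (join G H a b)"
proof (rule is_connectedI[of a])
  show "a \<in> verts (join G H a b)" using assms by simp
  fix v assume "v \<in> verts (join G H a b)"
  then consider "v \<in> verts G" | "v \<in> verts H" by auto
  then show "(adj (join G H a b))\<^sup>*\<^sup>* a v"
  proof cases
    case 1
    show ?thesis
      by (rule rtranclp_weaken[OF is_connectedD[OF assms(1,3) 1]]) (simp add: adj_def)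
  next
    case 2
    have "(adj (join G H a b))\<^sup>*\<^sup>* b v"
      by (rule rtranclp_weaken[OF is_connectedD[OF assms(2,4) 2]]) (simp add: adj_def)
    moreover have "adj (join G H a b) a b" by (simp add: adj_def)
    ultimately show ?thesis by (rule converse_rtranclp_into_rtranclp[rotated])
  qed
qed

lemma join_bridges_left:
  assumes "simple_graph G" and "simple_graph H" and "verts G \<inter> verts H = {}"
    and "a \<in> verts G" and "b \<in> verts H"
    and "acyclic_graph G" and xy: "{x, y} \<in> edges G"
  shows "\<not> (adj (delete_edge (join G H a b) {x, y}))\<^sup>*\<^sup>* x y"
proof
  assume r: "(adj (delete_edge (join G H a b) {x, y}))\<^sup>*\<^sup>* x y"
  let ?f = "\<lambda>z. if z \<in> verts G then z else a"
  have "(adj (delete_edge G {x, y}))\<^sup>*\<^sup>* (?f x) (?f y)"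
  proof (rule rtranclp_hom[OF r])
    fix u v assume "adj (delete_edge (join G H a b) {x, y}) u v"
    then consider "{u, v} \<in> edges G" "{u, v} \<noteq> {x, y}" | "{u, v} \<in> edges H" | "{u, v} = {a, b}"
      by (auto simp: adj_def)
    then show "(adj (delete_edge G {x, y}))\<^sup>*\<^sup>* (?f u) (?f v)"
    proof cases
      case 1
      then have "adj (delete_edge G {x, y}) u v" by (simp add: adj_def)
      then show ?thesis using simple_graph_edgeD[OF assms(1) 1(1)] by auto
    next
      case 2
      then have "u \<notin> verts G" "v \<notin> verts G" using simple_graph_edgeD[OF assms(2) 2] assms(3) by auto
      then show ?thesis by simp
    next
      case 3
      then show ?thesis using assms(3-5) by (auto simp: doubleton_eq_iff)
    qed
  qed
  then show False
    using acyclic_graph_bridge[OF assms(1,6) xy] simple_graph_edgeD[OF assms(1) xy] by simp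
qed

lemma acyclic_graph_join:
  assumes "simple_graph G" and "simple_graph H" and "verts G \<inter> verts H = {}"
    and "a \<in> verts G" and "b \<in> verts H" and "acyclic_graph G" and "acyclic_graph H"
  shows "acyclic_graph (join G H a b)"
proof -
  have ab: "a \<noteq> b" using assms by auto
  have s: "simple_graph (join G H a b)" using assms ab by (intro simple_graph_join) auto
  have mid: "\<not> (adj (delete_edge (join G H a b) {a, b}))\<^sup>*\<^sup>* a b"
  proof
    assume r: "(adj (delete_edge (join G H a b) {a, b}))\<^sup>*\<^sup>* a b"
    have "v \<in> verts G" if "(adj (delete_edge (join G H a b) {a, b}))\<^sup>*\<^sup>* a v" for v
      using that
    proof induction
      case (step y z)
      then have "{y, z} \<in> edges G \<or> {y, z} \<in> edges H" by (auto simp: adj_def)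
      then show ?case
        using step simple_graph_edgeD[OF assms(1)] simple_graph_edgeD[OF assms(2)] assms(3) by blast
    qed (use assms in simp)
    then show False using r assms by auto
  qed
  show ?thesis unfolding acyclic_graph_iff_bridges[OF s]
  proof (intro allI impI)
    fix x y assume "{x, y} \<in> edges (join G H a b)"
    then consider "{x, y} \<in> edges G" | "{x, y} \<in> edges H" | "{x, y} = {a, b}" by auto
    then show "\<not> (adj (delete_edge (join G H a b) {x, y}))\<^sup>*\<^sup>* x y"
    proof cases
      case 1
      then show ?thesis using join_bridges_left[OF assms(1-6)] by simp
    next
      case 2
      then show ?thesis using join_bridges_left[OF assms(2,1) _ assms(5,4,7)] assms(3)
        by (metis Int_commute join_commute)
    next
      case 3
      then consider "x = a" "y = b" | "x = b" "y = a" by (auto simp: doubleton_eq_iff)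
      then show ?thesis
        using mid adj_rtranclp_sym[of _ b a] unfolding 3 by cases blast+
    qed
  qed
qed

lemma degree_add_edge:
  assumes "finite (edges G)" and "{a, b} \<notin> edges G" and "edges H = insert {a, b} (edges G)"
  shows "degree H v = degree G v + (if v = a \<or> v = b then 1 else 0)"
proof -
  have "incident H v = (if v = a \<or> v = b then insert {a, b} (incident G v) else incident G v)"
    using assms(3) by (auto simp: incident_def)
  moreover have "finite (incident G v)" "{a, b} \<notin> incident G v"
    using assms by (auto simp: incident_def)
  ultimately show ?thesis by (simp add: degree_def)
qed

lemma degree_disjoint_sum:
  assumes "simple_graph G" and "simple_graph H" and "verts G \<inter> verts H = {}" and "v \<in> verts G"
  shows "degree (disjoint_sum G H) v = degree G v" and "degree (disjoint_sum H G) v = degree G v"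
proof -
  have "incident (disjoint_sum G H) v = incident G v" "incident (disjoint_sum H G) v = incident G v"
    using assms unfolding incident_def simple_graph_def by fastforce+
  then show "degree (disjoint_sum G H) v = degree G v" "degree (disjoint_sum H G) v = degree G v"
    by (simp_all add: degree_def)
qed

lemma degree_join:
  assumes "simple_graph G" and "simple_graph H" and "verts G \<inter> verts H = {}"
    and "a \<in> verts G" and "b \<in> verts H" and "v \<in> verts G"
  shows "degree (join G H a b) v = degree G v + (if v = a then 1 else 0)"
    and "degree (join H G b a) v = degree G v + (if v = a then 1 else 0)"
proof -
  have "{a, b} \<notin> edges (disjoint_sum G H)"
    using assms simple_graph_edgeD[of G a b] simple_graph_edgeD[of H a b] by auto
  moreover have "finite (edges (disjoint_sum G H))"
    using assms by (simp add: simple_graph_finite_edges)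
  ultimately have "degree (join G H a b) v =
      degree (disjoint_sum G H) v + (if v = a \<or> v = b then 1 else 0)"
    by (intro degree_add_edge) auto
  then show "degree (join G H a b) v = degree G v + (if v = a then 1 else 0)"
    using assms degree_disjoint_sum[OF assms(1-3,6)] by auto
  then show "degree (join H G b a) v = degree G v + (if v = a then 1 else 0)"
    by (simp add: join_commute)
qed

section \<open>Suppressing degree-two vertices\<close>

lemma suppress_stepI:
  assumes "v \<in> verts G" and "u \<noteq> w" and "incident G v = {{u, v}, {v, w}}"
    and "H = \<lparr>verts = verts G - {v}, edges = (edges G - {{u, v}, {v, w}}) \<union> {{u, w}}\<rparr>"
  shows "suppress_step G H"
  using assms unfolding suppress_step_def by blast

lemma suppress_step_subdivide:
  assumes "simple_graph G" and "n \<notin> verts G" and "e \<in> edges G"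
  shows "suppress_step (subdivide e n G) G"
proof -
  obtain p q where e: "e = {p, q}" "p \<noteq> q" "p \<in> verts G" "q \<in> verts G"
    using simple_graph_edgeE[OF assms(1,3)] .
  have pq: "{p, q} \<in> edges G" using assms e by simp
  have nn: "\<And>f. f \<in> edges G \<Longrightarrow> n \<notin> f" using assms by (auto simp: simple_graph_def)
  have "incident (subdivide e n G) n = {{p, n}, {n, q}}"
    using nn unfolding incident_def e edges_subdivide[OF pq] by auto
  moreover have "G = \<lparr>verts = verts (subdivide e n G) - {n},
      edges = (edges (subdivide e n G) - {{p, n}, {n, q}}) \<union> {{p, q}}\<rparr>"
  proof (rule ugraph_eqI)
    have "{p, n} \<notin> edges G" "{n, q} \<notin> edges G" using nn by auto
    then show "edges G = edges \<lparr>verts = verts (subdivide e n G) - {n},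
      edges = (edges (subdivide e n G) - {{p, n}, {n, q}}) \<union> {{p, q}}\<rparr>"
      using pq unfolding e edges_subdivide[OF pq] by (auto simp: insert_commute)
  qed (use assms in \<open>auto simp: verts_subdivide\<close>)
  ultimately show ?thesis
    using e(2) assms(3) by (intro suppress_stepI[of n _ p q]) (auto simp: verts_subdivide)
qed

lemma suppress_stepE:
  assumes "suppress_step G H" and "simple_graph G" and "acyclic_graph G"
  obtains n e where "n \<notin> verts H" "e \<in> edges H" "G = subdivide e n H" "simple_graph H" "acyclic_graph H"
proof -
  obtain u v w where v: "v \<in> verts G" "u \<noteq> w" and inc: "incident G v = {{u, v}, {v, w}}"
    and H: "H = \<lparr>verts = verts G - {v}, edges = (edges G - {{u, v}, {v, w}}) \<union> {{u, w}}\<rparr>"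
    using assms(1) unfolding suppress_step_def by blast
  have uv: "{u, v} \<in> edges G" "{v, w} \<in> edges G" using inc by (auto simp: incident_def)
  note d = simple_graph_edgeD[OF assms(2) uv(1)] simple_graph_edgeD[OF assms(2) uv(2)]
  have vonly: "f = {u, v} \<or> f = {v, w}" if "f \<in> edges G" "v \<in> f" for f
    using that inc by (auto simp: incident_def)
  have uw: "{u, w} \<notin> edges G"
  proof
    assume "{u, w} \<in> edges G"
    then have "(adj (delete_edge G {u, v}))\<^sup>*\<^sup>* u v"
      using uv d v by (intro rtranclp_2_steps[where b = w]) (auto simp: adj_def doubleton_eq_iff insert_commute)
    then show False using acyclic_graph_bridge[OF assms(2,3) uv(1)] by simp
  qed
  have s: "simple_graph H"
    using assms(2) d v vonly unfolding simple_graph_def H by (auto simp: card_2_iff)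
  have nH: "v \<notin> verts H" and eH: "{u, w} \<in> edges H" by (simp_all add: H)
  have G: "G = subdivide {u, w} v H"
  proof (rule ugraph_eqI)
    show "verts G = verts (subdivide {u, w} v H)"
      using v eH by (auto simp: verts_subdivide H)
    show "edges G = edges (subdivide {u, w} v H)"
      unfolding edges_subdivide[OF eH] using uv uw by (auto simp: H insert_commute)
  qed
  moreover have "acyclic_graph H" using acyclic_graph_subdivide_iff[OF s nH] assms(3) G by metis
  ultimately show thesis using that nH eH s by blast
qed

lemma suppress_steps_verts: "suppress_step\<^sup>*\<^sup>* G H \<Longrightarrow> verts H \<subseteq> verts G"
  by (induction rule: rtranclp_induct) (auto simp: suppress_step_def)

lemma suppress_steps_union:
  assumes "suppress_step\<^sup>*\<^sup>* G H" and "V \<inter> verts G \<subseteq> verts H" and "\<Union>D \<subseteq> V"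
  shows "suppress_step\<^sup>*\<^sup>* \<lparr>verts = verts G \<union> V, edges = edges G \<union> D\<rparr>
           \<lparr>verts = verts H \<union> V, edges = edges H \<union> D\<rparr>"
  using assms
proof (induction rule: converse_rtranclp_induct)
  case (step G G1)
  have sub: "verts H \<subseteq> verts G1" using suppress_steps_verts step(2) .
  obtain u v w where v: "v \<in> verts G" "u \<noteq> w" and inc: "incident G v = {{u, v}, {v, w}}"
    and H: "G1 = \<lparr>verts = verts G - {v}, edges = (edges G - {{u, v}, {v, w}}) \<union> {{u, w}}\<rparr>"
    using step(1) unfolding suppress_step_def by blast
  have "v \<notin> V" using step v sub unfolding H by auto
  then have vD: "\<And>f. f \<in> D \<Longrightarrow> v \<notin> f" using step by auto
  have "incident \<lparr>verts = verts G \<union> V, edges = edges G \<union> D\<rparr> v = {{u, v}, {v, w}}"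
    using inc vD by (auto simp: incident_def)
  moreover have "\<lparr>verts = verts G1 \<union> V, edges = edges G1 \<union> D\<rparr> =
     \<lparr>verts = verts \<lparr>verts = verts G \<union> V, edges = edges G \<union> D\<rparr> - {v},
      edges = (edges \<lparr>verts = verts G \<union> V, edges = edges G \<union> D\<rparr> - {{u, v}, {v, w}}) \<union> {{u, w}}\<rparr>"
    using \<open>v \<notin> V\<close> vD unfolding H by (intro ugraph_eqI) auto
  ultimately have "suppress_step \<lparr>verts = verts G \<union> V, edges = edges G \<union> D\<rparr>
      \<lparr>verts = verts G1 \<union> V, edges = edges G1 \<union> D\<rparr>"
    using v by (intro suppress_stepI[of v _ u w]) auto
  moreover have "V \<inter> verts G1 \<subseteq> verts H" using step unfolding H by auto
  ultimately show ?case using step.IH step.prems(2) by (metis converse_rtranclp_into_rtranclp)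
qed simp

text \<open>Every edge of the suppressed graph comes from a path; subdividing the edge of this path at a
  prescribed end \<open>u\<close> commutes with the suppression.\<close>

lemma suppress_steps_lift_subdivide:
  assumes "suppress_step\<^sup>*\<^sup>* S H" and "simple_graph S" and "acyclic_graph S"
    and "{u, w} \<in> edges H" and "n \<notin> verts S"
  shows "\<exists>e\<in>edges S. u \<in> e \<and> suppress_step\<^sup>*\<^sup>* (subdivide e n S) (subdivide {u, w} n H)"
  using assms
proof (induction rule: converse_rtranclp_induct)
  case base
  then show ?case by (intro bexI[of _ "{u, w}"]) auto
next
  case (step S S1)
  obtain v d where vd: "v \<notin> verts S1" "d \<in> edges S1" and S: "S = subdivide d v S1"
    and S1: "simple_graph S1" "acyclic_graph S1"
    using suppress_stepE[OF step(1) step.prems(1,2)] .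
  have n: "n \<notin> verts S1" "n \<noteq> v" using step.prems(4) vd by (auto simp: S verts_subdivide)
  have nn: "\<And>f. f \<in> edges S1 \<Longrightarrow> v \<notin> f" "\<And>f. f \<in> edges S1 \<Longrightarrow> n \<notin> f"
    using S1 vd n by (auto simp: simple_graph_def)
  obtain e1 where e1: "e1 \<in> edges S1" "u \<in> e1"
    and r: "suppress_step\<^sup>*\<^sup>* (subdivide e1 n S1) (subdivide {u, w} n H)"
    using step.IH[OF S1 step.prems(3) n(1)] by blast
  obtain q where q: "e1 = {u, q}" "u \<noteq> q" "u \<in> verts S1" "q \<in> verts S1"
    using simple_graph_edge_atE[OF S1(1) e1] .
  have uq: "{u, q} \<in> edges S1" using e1 q by simp
  have simple: "simple_graph (subdivide e1 n S1)" and nv: "v \<notin> verts (subdivide e1 n S1)"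
    using simple_graph_subdivide[OF S1(1) n(1)] vd n e1 by (auto simp: verts_subdivide)
  show ?case
  proof (cases "e1 = d")
    case False
    obtain p' q' where d: "d = {p', q'}" by (rule simple_graph_edgeE[OF S1(1) vd(2)])
    have dE: "{p', q'} \<in> edges S1" using vd d by simp
    have d1: "d \<in> edges (subdivide e1 n S1)"
      using False vd e1 unfolding q edges_subdivide[OF uq] by auto
    have e1S: "e1 \<in> edges S" using False e1 unfolding S d edges_subdivide[OF dE] by auto
    have "subdivide e1 n S = subdivide d v (subdivide e1 n S1)"
      unfolding S by (rule subdivide_commute[OF S1(1) False n(1) vd(1) e1(1) vd(2)])
    then have "suppress_step (subdivide e1 n S) (subdivide e1 n S1)"
      using suppress_step_subdivide[OF simple nv d1] by simp
    then show ?thesis using e1S e1 r by (meson converse_rtranclp_into_rtranclp)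
  next
    case True
    have ES: "edges S = edges S1 - {{u, q}} \<union> {{u, v}, {q, v}}"
      using edges_subdivide[OF uq] True q S by simp
    have uvS: "{u, v} \<in> edges S" by (simp add: ES)
    have ES': "edges (subdivide e1 n S1) = edges S1 - {{u, q}} \<union> {{u, n}, {q, n}}"
      using edges_subdivide[OF uq] q by simp
    have nq: "{n, q} \<in> edges (subdivide e1 n S1)" by (simp add: ES' insert_commute)
    have "subdivide {u, v} n S = subdivide {n, q} v (subdivide e1 n S1)"
    proof (rule ugraph_eqI)
      show "verts (subdivide {u, v} n S) = verts (subdivide {n, q} v (subdivide e1 n S1))"
        using vd e1 uvS nq by (auto simp: verts_subdivide S)
      have "{u, v} \<notin> edges S1" "{n, q} \<notin> edges S1" "{u, v} \<noteq> {q, v}" "{u, n} \<noteq> {n, q}"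
        using nn q(2) by (auto simp: doubleton_eq_iff)
      then show "edges (subdivide {u, v} n S) = edges (subdivide {n, q} v (subdivide e1 n S1))"
        unfolding edges_subdivide[OF uvS] edges_subdivide[OF nq] ES ES'
        by (auto simp: insert_commute)
    qed
    then have "suppress_step (subdivide {u, v} n S) (subdivide e1 n S1)"
      using suppress_step_subdivide[OF simple nv nq] by simp
    then show ?thesis using uvS r by (meson converse_rtranclp_into_rtranclp insertI1)
  qed
qed

lemma is_connected_subdivideD:
  assumes "simple_graph G" and "n \<notin> verts G" and "e \<in> edges G" and "is_connected (subdivide e n G)"
  shows "is_connected G"
proof -
  obtain p q where e: "e = {p, q}" "p \<noteq> q" "p \<in> verts G" "q \<in> verts G"
    using simple_graph_edgeE[OF assms(1,3)] .
  have pq: "{p, q} \<in> edges G" using assms e by simp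
  have nn: "\<And>f. f \<in> edges G \<Longrightarrow> n \<notin> f" using assms by (auto simp: simple_graph_def)
  have npq: "n \<noteq> p" "n \<noteq> q" using e assms by auto
  let ?f = "\<lambda>z. if z = n then p else z"
  have apq: "adj G p q" "adj G q p" using pq by (auto simp: adj_def insert_commute)
  have *: "(adj G)\<^sup>*\<^sup>* (?f x) (?f y)" if "adj (subdivide e n G) x y" for x y
  proof -
    have "{x, y} \<in> edges G \<or> {x, y} = {p, n} \<or> {x, y} = {q, n}"
      using that unfolding adj_def e edges_subdivide[OF pq] by auto
    then show ?thesis
    proof (elim disjE)
      assume "{x, y} \<in> edges G"
      moreover from this have "x \<noteq> n" "y \<noteq> n" using nn by auto
      ultimately show ?thesis by (auto simp: adj_def)
    qed (use apq npq in \<open>auto simp: doubleton_eq_iff\<close>)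
  qed
  show ?thesis
  proof (rule is_connectedI[of p])
    fix v assume v: "v \<in> verts G"
    then have "(adj (subdivide e n G))\<^sup>*\<^sup>* p v"
      using assms(3,4) e by (auto intro!: is_connectedD simp: verts_subdivide)
    from rtranclp_hom[OF this, of "adj G" ?f] * have "(adj G)\<^sup>*\<^sup>* (?f p) (?f v)" by blast
    moreover have "?f p = p" "?f v = v" using v assms(2) by auto
    ultimately show "(adj G)\<^sup>*\<^sup>* p v" by argo
  qed (use e in simp)
qed

lemma suppress_steps_tree:
  assumes "suppress_step\<^sup>*\<^sup>* G H" and "simple_graph G" and "acyclic_graph G" and "is_connected G"
  shows "simple_graph H \<and> acyclic_graph H \<and> is_connected H"
  using assms
proof (induction rule: rtranclp_induct)
  case (step H H')
  then have H: "simple_graph H" "acyclic_graph H" "is_connected H" by auto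
  obtain n e where "n \<notin> verts H'" "e \<in> edges H'" "H = subdivide e n H'" "simple_graph H'" "acyclic_graph H'"
    using suppress_stepE[OF step(2) H(1,2)] .
  then show ?case using H(3) is_connected_subdivideD[of H' n e] by simp
qed simp

lemma suppress_step_degree: "suppress_step G H \<Longrightarrow> \<exists>v\<in>verts G. degree G v = 2"
  unfolding suppress_step_def degree_def
proof (elim exE conjE)
  fix u v w assume "v \<in> verts G" "u \<noteq> w" "incident G v = {{u, v}, {v, w}}"
  moreover from this have "{u, v} \<noteq> {v, w}" by (auto simp: doubleton_eq_iff)
  ultimately show "\<exists>v\<in>verts G. card (incident G v) = 2" by (intro bexI[of _ v]) auto
qed

lemma suppress_steps_stuck:
  assumes "suppress_step\<^sup>*\<^sup>* G H" and "\<forall>v\<in>verts G. degree G v \<noteq> 2"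
  shows "H = G"
  using assms(1)
proof (cases rule: converse_rtranclpE)
  case (step y)
  then show ?thesis using suppress_step_degree[of G y] assms(2) by blast
qed simp

lemma suppress_steps_edgeless:
  assumes "suppress_step\<^sup>*\<^sup>* G H" and "edges H = {}"
  shows "H = G"
  using assms(1)
proof cases
  case (rtrancl_into_rtrancl H')
  then show ?thesis using assms(2) by (auto simp: suppress_step_def)
qed simp

lemma suppress_step_disjoint_sum:
  assumes "suppress_step (disjoint_sum A B) H" and "simple_graph A" and "simple_graph B"
    and "verts A \<inter> verts B = {}"
  shows "(\<exists>A1. suppress_step A A1 \<and> H = disjoint_sum A1 B) \<or>
         (\<exists>B1. suppress_step B B1 \<and> H = disjoint_sum A B1)"
proof -
  obtain u v w where v: "v \<in> verts A \<union> verts B" "u \<noteq> w"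
    and inc: "incident (disjoint_sum A B) v = {{u, v}, {v, w}}"
    and H: "H = \<lparr>verts = verts A \<union> verts B - {v},
                 edges = (edges A \<union> edges B - {{u, v}, {v, w}}) \<union> {{u, w}}\<rparr>"
    using assms(1) unfolding suppress_step_def by auto
  have *: "\<exists>A1. suppress_step A A1 \<and> H = disjoint_sum A1 B"
    if vA: "v \<in> verts A" and s: "simple_graph B" and d: "verts A \<inter> verts B = {}"
      and inc: "incident (disjoint_sum A B) v = {{u, v}, {v, w}}"
      and H: "H = \<lparr>verts = verts A \<union> verts B - {v},
                 edges = (edges A \<union> edges B - {{u, v}, {v, w}}) \<union> {{u, w}}\<rparr>" for A B
  proof -
    have vB: "\<And>f. f \<in> edges B \<Longrightarrow> v \<notin> f" using s d vA unfolding simple_graph_def by blast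
    then have "incident A v = {{u, v}, {v, w}}"
      using inc unfolding incident_def by auto
    moreover have "{u, v} \<notin> edges B" "{v, w} \<notin> edges B" using vB by auto
    moreover have "v \<notin> verts B" using d vA by auto
    ultimately show ?thesis
      by (intro exI[of _ "\<lparr>verts = verts A - {v}, edges = (edges A - {{u, v}, {v, w}}) \<union> {{u, w}}\<rparr>"] conjI
          suppress_stepI[of v A u w] ugraph_eqI) (use vA v(2) in \<open>auto simp: H\<close>)
  qed
  have comm: "disjoint_sum A B = disjoint_sum B A" for A B :: "'a ugraph"
    by (rule ugraph_eqI) auto
  show ?thesis
  proof (cases "v \<in> verts A")
    case True
    then show ?thesis using *[of A B] assms inc H by blast
  next
    case False
    then show ?thesis using *[of B A] v assms inc H by (simp add: comm[of A] Un_commute Int_commute)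
  qed
qed

lemma suppress_steps_disjoint_sum:
  assumes "suppress_step\<^sup>*\<^sup>* (disjoint_sum A B) H"
    and "simple_graph A" and "acyclic_graph A" and "is_connected A"
    and "simple_graph B" and "acyclic_graph B" and "is_connected B"
    and "verts A \<inter> verts B = {}"
  shows "\<exists>A1 B1. H = disjoint_sum A1 B1 \<and> suppress_step\<^sup>*\<^sup>* A A1 \<and> suppress_step\<^sup>*\<^sup>* B B1"
  using assms(1)
proof (induction rule: rtranclp_induct)
  case (step H H')
  then obtain A1 B1 where H: "H = disjoint_sum A1 B1"
    and r: "suppress_step\<^sup>*\<^sup>* A A1" "suppress_step\<^sup>*\<^sup>* B B1" by blast
  have "simple_graph A1" "simple_graph B1"
    using suppress_steps_tree r assms by blast+
  moreover have "verts A1 \<inter> verts B1 = {}"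
    using r[THEN suppress_steps_verts] assms(8) by blast
  ultimately consider A2 where "suppress_step A1 A2" "H' = disjoint_sum A2 B1"
    | B2 where "suppress_step B1 B2" "H' = disjoint_sum A1 B2"
    using suppress_step_disjoint_sum[of A1 B1 H'] step(2) unfolding H by blast
  then show ?case
  proof cases
    case 1
    then show ?thesis using r rtranclp.rtrancl_into_rtrancl[OF r(1)] by blast
  next
    case 2
    then show ?thesis using r rtranclp.rtrancl_into_rtrancl[OF r(2)] by blast
  qed
qed blast

lemma adj_rtranclp_disjoint_sum:
  assumes "simple_graph A" and "simple_graph B" and "verts A \<inter> verts B = {}"
    and "v \<in> verts A" and "(adj (disjoint_sum A B))\<^sup>*\<^sup>* v w"
  shows "w \<in> verts A"
  using assms(5)
proof induction
  case (step y z)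
  then have "{y, z} \<in> edges A \<or> {y, z} \<in> edges B" by (auto simp: adj_def)
  then show ?case
    using step simple_graph_edgeD[OF assms(1)] simple_graph_edgeD[OF assms(2)] assms(3) by blast
qed (use assms in simp)

lemma component_disjoint_sum:
  assumes "simple_graph A" and "simple_graph B" and "verts A \<inter> verts B = {}"
    and "is_connected A" and "v \<in> verts A"
  shows "induced (disjoint_sum A B) {w \<in> verts (disjoint_sum A B). (adj (disjoint_sum A B))\<^sup>*\<^sup>* v w} = A"
proof -
  have "(adj (disjoint_sum A B))\<^sup>*\<^sup>* v w" if "w \<in> verts A" for w
    by (rule rtranclp_weaken[OF is_connectedD[OF assms(4,5) that]]) (simp add: adj_def)
  then have V: "{w \<in> verts (disjoint_sum A B). (adj (disjoint_sum A B))\<^sup>*\<^sup>* v w} = verts A"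
    using adj_rtranclp_disjoint_sum[OF assms(1-3,5)] by auto
  have "e \<notin> edges B" if "e \<subseteq> verts A" for e
  proof
    assume "e \<in> edges B"
    then have "e = {}" using that assms(2,3) by (auto simp: simple_graph_def)
    then show False using \<open>e \<in> edges B\<close> assms(2) by (auto simp: simple_graph_def)
  qed
  then show ?thesis unfolding V using assms(1)
    by (intro ugraph_eqI) (auto simp: induced_def simple_graph_def)
qed

lemma components_disjoint_sum:
  assumes "simple_graph A" and "simple_graph B" and "verts A \<inter> verts B = {}"
    and "is_connected A" and "is_connected B"
  shows "components (disjoint_sum A B) = {A, B}"
proof -
  have comm: "disjoint_sum A B = disjoint_sum B A" by (rule ugraph_eqI) auto
  let ?c = "\<lambda>v. induced (disjoint_sum A B) {w \<in> verts (disjoint_sum A B). (adj (disjoint_sum A B))\<^sup>*\<^sup>* v w}"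
  have 1: "?c v = A" if "v \<in> verts A" for v
    using component_disjoint_sum[OF assms(1-4) that] .
  have 2: "?c v = B" if "v \<in> verts B" for v
    using component_disjoint_sum[OF assms(2,1) _ assms(5) that] assms(3) unfolding comm by auto
  obtain a b where "a \<in> verts A" "b \<in> verts B" using assms(4,5) by (auto simp: is_connected_def)
  moreover have "components (disjoint_sum A B) = ?c ` (verts A \<union> verts B)"
    unfolding components_def by (auto simp: image_def)
  ultimately show ?thesis using 1 2 by (auto simp: image_Un intro!: image_eqI)
qed

section \<open>Isomorphisms\<close>

definition graph_iso :: "('v \<Rightarrow> 'v) \<Rightarrow> 'v ugraph \<Rightarrow> 'v ugraph \<Rightarrow> bool" where
  "graph_iso f G H \<longleftrightarrow> bij_betw f (verts G) (verts H) \<and> edges H = (`) f ` edges G"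

lemma graph_iso_degree:
  assumes "simple_graph G" and "graph_iso f G H" and "v \<in> verts G"
  shows "degree H (f v) = degree G v"
proof -
  have inj: "inj_on f (verts G)" using assms by (auto simp: graph_iso_def bij_betw_def)
  have sub: "edges G \<subseteq> Pow (verts G)" using assms(1) by (auto simp: simple_graph_def)
  have "f v \<in> f ` e \<longleftrightarrow> v \<in> e" if "e \<in> edges G" for e
    using inj_on_image_mem_iff[OF inj assms(3)] that sub by auto
  then have "incident H (f v) = (`) f ` incident G v"
    using assms(2) by (auto simp: incident_def graph_iso_def)
  moreover have "inj_on ((`) f) (incident G v)"
    by (rule inj_on_subset[OF inj_on_image_Pow[OF inj]]) (use sub in \<open>auto simp: incident_def\<close>)
  ultimately show ?thesis by (simp add: degree_def card_image)
qed

lemma graph_iso_subdivide: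
  assumes "simple_graph G" and "graph_iso f G H" and "{p, q} \<in> edges G"
    and "n \<notin> verts G" and "m \<notin> verts H"
  shows "graph_iso (f(n := m)) (subdivide {p, q} n G) (subdivide {f p, f q} m H)"
proof -
  have inj: "inj_on f (verts G)" and im: "f ` verts G = verts H"
    using assms by (auto simp: graph_iso_def bij_betw_def)
  have sub: "edges G \<subseteq> Pow (verts G)" using assms(1) by (auto simp: simple_graph_def)
  have EH: "edges H = (`) f ` edges G" using assms by (auto simp: graph_iso_def)
  have fpq: "{f p, f q} \<in> edges H" unfolding EH using assms(3) by (metis image_empty image_eqI image_insert)
  have pq: "p \<in> verts G" "q \<in> verts G" using simple_graph_edgeD[OF assms(1,3)] by auto
  have "p \<noteq> n" "q \<noteq> n" using pq assms by auto
  have bij: "bij_betw (f(n := m)) (verts (subdivide {p, q} n G)) (verts (subdivide {f p, f q} m H))"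
    unfolding verts_subdivide[OF assms(3)] verts_subdivide[OF fpq] bij_betw_def
    using inj im assms(4,5) by (auto simp: inj_on_def fun_upd_image)
  have same: "(f(n := m)) ` e = f ` e" if "e \<in> edges G" for e
    using that sub assms(4) by (auto simp: fun_upd_image)
  have "(`) (f(n := m)) ` (edges G - {{p, q}}) = (`) f ` (edges G - {{p, q}})"
    by (rule image_cong) (use same in auto)
  also have "\<dots> = (`) f ` edges G - {f ` {p, q}}"
    using inj_on_image_set_diff[OF inj_on_image_Pow[OF inj], of "edges G" "{{p, q}}"] sub assms(3)
    by auto
  finally have "(`) (f(n := m)) ` (edges G - {{p, q}}) = edges H - {{f p, f q}}"
    by (simp add: EH)
  then have "edges (subdivide {f p, f q} m H) = (`) (f(n := m)) ` edges (subdivide {p, q} n G)"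
    unfolding edges_subdivide[OF assms(3)] edges_subdivide[OF fpq] image_Un
    using \<open>p \<noteq> n\<close> \<open>q \<noteq> n\<close> by simp
  then show ?thesis using bij by (simp add: graph_iso_def)
qed

lemma graph_iso_join:
  assumes "simple_graph G1" and "simple_graph G2" and "graph_iso f G1 H1" and "graph_iso g G2 H2"
    and "verts G1 \<inter> verts G2 = {}" and "verts H1 \<inter> verts H2 = {}"
    and "a \<in> verts G1" and "b \<in> verts G2"
  shows "graph_iso (\<lambda>v. if v \<in> verts G1 then f v else g v) (join G1 G2 a b) (join H1 H2 (f a) (g b))"
proof -
  define h where "h = (\<lambda>v. if v \<in> verts G1 then f v else g v)"
  have 1: "h v = f v" if "v \<in> verts G1" for v using that by (simp add: h_def)
  have 2: "h v = g v" if "v \<in> verts G2" for v using that assms(5) by (auto simp: h_def)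
  have "bij_betw h (verts G1) (verts H1)"
    using assms(3) 1 unfolding graph_iso_def by (subst bij_betw_cong[of _ _ f]) auto
  moreover have "bij_betw h (verts G2) (verts H2)"
    using assms(4) 2 unfolding graph_iso_def by (subst bij_betw_cong[of _ _ g]) auto
  ultimately have "bij_betw h (verts G1 \<union> verts G2) (verts H1 \<union> verts H2)"
    using assms(6) by (rule bij_betw_combine)
  moreover have "h ` e = f ` e" if "e \<in> edges G1" for e
    by (rule image_cong[OF refl], rule 1) (use that assms(1) in \<open>auto simp: simple_graph_def\<close>)
  then have "(`) h ` edges G1 = edges H1"
    using assms(3) by (simp add: graph_iso_def cong: image_cong_simp)
  moreover have "h ` e = g ` e" if "e \<in> edges G2" for e
    by (rule image_cong[OF refl], rule 2) (use that assms(2) in \<open>auto simp: simple_graph_def\<close>)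
  then have "(`) h ` edges G2 = edges H2"
    using assms(4) by (simp add: graph_iso_def cong: image_cong_simp)
  moreover have "h ` {a, b} = {f a, g b}" using 1[OF assms(7)] 2[OF assms(8)] by simp
  ultimately show ?thesis unfolding h_def[symmetric] graph_iso_def join_simps image_Un image_insert by simp
qed

section \<open>Cutting a tree at an edge\<close>

text \<open>\<open>A'\<close> is the piece of a tree left by cutting an edge at \<open>a\<close>, and \<open>A\<close> is \<open>A'\<close> after suppression
  of \<open>a\<close>, if \<open>a\<close> has degree two; \<open>u\<close> is then a neighbour of \<open>a\<close>.\<close>

definition attachment_at :: "'v ugraph \<Rightarrow> 'v \<Rightarrow> 'v ugraph \<Rightarrow> 'v \<Rightarrow> bool" where
  "attachment_at A' a A u \<longleftrightarrow> A' = point a \<and> A = point a \<and> u = a \<or>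
     simple_graph A \<and> a \<notin> verts A \<and> (\<exists>w. {u, w} \<in> edges A \<and> A' = subdivide {u, w} a A)"

definition attachment :: "'v ugraph \<Rightarrow> 'v \<Rightarrow> 'v ugraph \<Rightarrow> bool" where
  "attachment A' a A \<longleftrightarrow> (\<exists>u. attachment_at A' a A u)"

definition tree_split ::
  "'v ugraph \<Rightarrow> 'v ugraph \<Rightarrow> 'v \<Rightarrow> 'v ugraph \<Rightarrow> 'v ugraph \<Rightarrow> 'v \<Rightarrow> 'v ugraph \<Rightarrow> bool" where
  "tree_split T A' a A B' b B \<longleftrightarrow> T = join A' B' a b \<and> verts A' \<inter> verts B' = {} \<and>
     simple_graph A' \<and> simple_graph B' \<and> a \<in> verts A' \<and> b \<in> verts B' \<and>
     attachment A' a A \<and> attachment B' b B"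

lemma attachment_point [simp]: "attachment (point x) x (point x)"
  by (auto simp: attachment_def attachment_at_def)

lemma connected_single:
  assumes "simple_graph G" and "is_connected G" and "a \<in> verts G" and "degree G a = 0"
  shows "G = point a"
proof -
  have "finite (incident G a)"
    using simple_graph_finite_edges[OF assms(1)] by (simp add: incident_def)
  then have none: "\<not> (\<exists>e\<in>edges G. a \<in> e)"
    using assms(4) by (auto simp: degree_def incident_def)
  then have "verts G = {a}" using connected_incident_nonempty[OF assms(2,3)] assms(3) by blast
  moreover have "edges G = {}"
  proof (rule ccontr)
    assume "edges G \<noteq> {}"
    then obtain e where "e \<in> edges G" by blast
    then show False using simple_graph_edgeE[OF assms(1) \<open>e \<in> edges G\<close>] none \<open>verts G = {a}\<close> by auto
  qed
  ultimately show ?thesis by (intro ugraph_eqI) auto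
qed

lemma attachmentI:
  assumes "simple_graph A'" and "acyclic_graph A'" and "is_connected A'" and "a \<in> verts A'"
    and "\<forall>v\<in>verts A' - {a}. degree A' v \<noteq> 2" and "degree A' a = 0 \<or> degree A' a = 2"
    and "suppress_step\<^sup>*\<^sup>* A' A" and "\<forall>v\<in>verts A. degree A v \<noteq> 2"
  shows "attachment A' a A"
proof (cases "degree A' a = 0")
  case True
  then have "A' = point a" by (rule connected_single[OF assms(1,3,4)])
  moreover from this have "A = A'" using suppress_steps_stuck[OF assms(7)] by simp
  ultimately show ?thesis by (auto simp: attachment_def attachment_at_def)
next
  case False
  then have d2: "degree A' a = 2" using assms(6) by simp
  from assms(7) show ?thesis
  proof (cases rule: converse_rtranclpE)
    case base
    then show ?thesis using assms(4,8) d2 by auto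
  next
    case (step A1)
    obtain n e where n: "n \<notin> verts A1" "e \<in> edges A1" "A' = subdivide e n A1"
      and A1: "simple_graph A1" "acyclic_graph A1"
      using suppress_stepE[OF step(1) assms(1,2)] .
    note deg = degree_subdivide[OF A1(1) n(1,2), folded n(3)]
    have "n \<in> verts A'" using n by (simp add: verts_subdivide)
    then have "n = a" using deg[of n] assms(5) by auto
    have "degree A1 v \<noteq> 2" if "v \<in> verts A1" for v
    proof -
      have "v \<noteq> a" "v \<in> verts A'" using that n \<open>n = a\<close> by (auto simp: verts_subdivide)
      then show ?thesis using deg[of v] assms(5) \<open>n = a\<close> by auto
    qed
    then have "A = A1" using suppress_steps_stuck[OF step(2)] by auto
    moreover obtain u w where "e = {u, w}" by (rule simple_graph_edgeE[OF A1(1) n(2)])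
    ultimately show ?thesis using n A1 \<open>n = a\<close> unfolding attachment_def attachment_at_def by blast
  qed
qed

lemma attachment_leaves:
  assumes "attachment A' a A" and "verts A' \<subseteq> verts T"
    and "\<And>v. v \<in> verts A' \<Longrightarrow> degree T v = degree A' v + (if v = a then 1 else 0)"
  shows "leaves T \<inter> verts A' = leaves A"
  using assms(1) unfolding attachment_def attachment_at_def
proof (elim disjE exE conjE)
  assume "A' = point a" "A = point a"
  then show ?thesis using assms(2,3) by (auto simp: leaves_def)
next
  fix u w assume A: "simple_graph A" "a \<notin> verts A" "{u, w} \<in> edges A" "A' = subdivide {u, w} a A"
  note deg = degree_subdivide[OF A(1-3), folded A(4)]
  have V: "verts A' = insert a (verts A)" using A by (simp add: verts_subdivide)
  have "v \<in> leaves T \<longleftrightarrow> v \<in> leaves A" if "v \<in> verts A" for v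
    using that assms(2,3) A(2) deg[of v] V by (auto simp: leaves_def)
  moreover have "a \<notin> leaves T" using assms(3)[of a] deg[of a] V by (auto simp: leaves_def)
  ultimately show ?thesis using A(2) V by (auto simp: leaves_def)
qed

lemma tree_split_commute: "tree_split T A' a A B' b B \<Longrightarrow> tree_split T B' b B A' a A"
  by (auto simp: tree_split_def join_commute)

lemma tree_split_leaves:
  assumes "tree_split T A' a A B' b B"
  shows "leaves T = leaves A \<union> leaves B"
proof -
  have *: "leaves T \<inter> verts A' = leaves A" if "tree_split T A' a A B' b B" for A' a A B' b B
    using that unfolding tree_split_def
    by (intro attachment_leaves[of A' a A T]) (auto simp: degree_join)
  have "leaves T \<subseteq> verts A' \<union> verts B'" using assms by (auto simp: leaves_def tree_split_def)
  then show ?thesis using *[OF assms] *[OF tree_split_commute[OF assms]] by blast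
qed

lemma phylo_tree_simps:
  assumes "phylo_tree Y T"
  shows "simple_graph T" "is_connected T" "acyclic_graph T" "leaves T = Y"
    and "v \<in> verts T \<Longrightarrow> degree T v \<le> 1 \<or> degree T v = 3"
  using assms by (auto simp: phylo_tree_def phylo_network_def leaves_def)

lemma adj_induced: "adj (induced G W) u v \<longleftrightarrow> adj G u v \<and> u \<in> W \<and> v \<in> W"
  by (auto simp: adj_def induced_def)

lemma is_connected_component:
  assumes "simple_graph G" and "r \<in> verts G"
  shows "is_connected (induced G {w \<in> verts G. (adj G)\<^sup>*\<^sup>* r w})" (is "is_connected ?I")
proof (rule is_connectedI[of r])
  fix v assume "v \<in> verts ?I"
  then have "(adj G)\<^sup>*\<^sup>* r v" by (simp add: induced_def)
  then show "(adj ?I)\<^sup>*\<^sup>* r v"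
  proof induction
    case (step y z)
    then have "y \<in> verts G" "z \<in> verts G" using simple_graph_adjD[OF assms(1)] by auto
    then have "adj ?I y z" using step(1,2) by (simp add: adj_induced rtranclp.rtrancl_into_rtrancl)
    then show ?case using step.IH by auto
  qed simp
qed (use assms in \<open>simp add: induced_def\<close>)

lemma tree_split_delete_edge:
  assumes T: "phylo_tree Y T" and e: "e \<in> edges T" and H: "suppresses_to (delete_edge T e) H"
  shows "\<exists>A' a A B' b B. tree_split T A' a A B' b B \<and> components H = {A, B}"
proof -
  note T' = phylo_tree_simps[OF T]
  obtain u v where uv: "e = {u, v}" "u \<noteq> v" "u \<in> verts T" "v \<in> verts T"
    using simple_graph_edgeE[OF T'(1) e] .
  define D where "D = delete_edge T e"
  have D: "verts D = verts T" "edges D = edges T - {{u, v}}" by (simp_all add: D_def uv)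
  have sD: "simple_graph D" using T'(1) unfolding simple_graph_def D by auto
  define W where "W = (\<lambda>r. {w \<in> verts D. (adj D)\<^sup>*\<^sup>* r w})"
  define A' where "A' = induced D (W u)"
  define B' where "B' = induced D (W v)"
  have VA: "verts A' = W u" "verts B' = W v" by (simp_all add: A'_def B'_def induced_def)
  have uW: "u \<in> W u" "v \<in> W v" using uv by (simp_all add: W_def D)
  have bridge: "\<not> (adj D)\<^sup>*\<^sup>* u v" using acyclic_graph_bridge[OF T'(1,3)] e unfolding uv D_def by simp
  have disj: "W u \<inter> W v = {}"
  proof -
    have False if "(adj D)\<^sup>*\<^sup>* u w" "(adj D)\<^sup>*\<^sup>* v w" for w
      using that bridge adj_rtranclp_sym[of D v w] by (metis rtranclp_trans)
    then show ?thesis by (auto simp: W_def)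
  qed
  have closed: "y \<in> W r" if "x \<in> W r" "{x, y} \<in> edges D" for x y r
  proof -
    have "adj D x y" using that(2) by (simp add: adj_def)
    then show ?thesis using that(1) simple_graph_edgeD[OF sD that(2)] unfolding W_def by auto
  qed
  have cover: "W u \<union> W v = verts T"
  proof -
    have "w \<in> W u \<union> W v" if "(adj T)\<^sup>*\<^sup>* u w" for w using that
    proof induction
      case (step y z)
      show ?case
      proof (cases "{y, z} = {u, v}")
        case True
        then have "z = u \<or> z = v" by (auto simp: doubleton_eq_iff)
        then show ?thesis using uW by auto
      next
        case False
        then have "{y, z} \<in> edges D" using step(2) by (simp add: D adj_def)
        then show ?thesis using step(3) closed by blast
      qed
    qed (use uW in simp)
    moreover have "(adj T)\<^sup>*\<^sup>* u w" if "w \<in> verts T" for w using is_connectedD[OF T'(2) uv(3) that] .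
    ultimately show ?thesis by (auto simp: W_def D)
  qed
  have ED: "edges D = edges A' \<union> edges B'"
  proof -
    have "f \<in> edges A' \<union> edges B'" if f: "f \<in> edges D" for f
    proof -
      obtain x y where xy: "f = {x, y}" "x \<in> verts D" by (rule simple_graph_edgeE[OF sD f])
      then have "x \<in> W u \<or> x \<in> W v" using cover D by auto
      then show ?thesis using closed[of x _ y] f unfolding xy A'_def B'_def induced_def by auto
    qed
    then show ?thesis by (auto simp: A'_def B'_def induced_def)
  qed
  have sum: "D = disjoint_sum A' B'"
    by (rule ugraph_eqI) (use ED cover D VA in auto)
  have sub: "edges A' \<subseteq> edges T" "edges B' \<subseteq> edges T" "verts A' \<subseteq> verts T" "verts B' \<subseteq> verts T"
    using ED[symmetric] D(2) VA cover by blast+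
  have sA: "simple_graph A'" "simple_graph B'"
    using sD unfolding simple_graph_def A'_def B'_def induced_def W_def by auto
  have cA: "is_connected A'" "is_connected B'"
    using is_connected_component[OF sD] uv D unfolding A'_def B'_def W_def by auto
  have aA: "acyclic_graph A'" "acyclic_graph B'"
    using acyclic_graph_mono[OF T'(3)] sub by auto
  have dj: "verts A' \<inter> verts B' = {}" using disj VA by simp
  have ab: "u \<in> verts A'" "v \<in> verts B'" using uW VA by auto
  have TJ: "T = join A' B' u v"
    by (rule ugraph_eqI) (use e uv(1) ED[symmetric] D(2) cover VA in auto)
  obtain A B where AB: "H = disjoint_sum A B" "suppress_step\<^sup>*\<^sup>* A' A" "suppress_step\<^sup>*\<^sup>* B' B"
    using suppress_steps_disjoint_sum[of A' B' H] sA cA aA dj H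
    unfolding suppresses_to_def D_def[symmetric] sum by blast
  have tA: "simple_graph A" "is_connected A" and tB: "simple_graph B" "is_connected B"
    using suppress_steps_tree AB sA cA aA by blast+
  have djAB: "verts A \<inter> verts B = {}" using suppress_steps_verts AB dj by blast
  have degH: "degree H v \<noteq> 2" if "v \<in> verts H" for v using H that by (auto simp: suppresses_to_def)
  have dA: "\<forall>v\<in>verts A. degree A v \<noteq> 2"
    using degH degree_disjoint_sum(1)[OF tA(1) tB(1) djAB] unfolding AB by force
  have dB: "\<forall>v\<in>verts B. degree B v \<noteq> 2"
    using degH degree_disjoint_sum(2)[OF tB(1) tA(1)] djAB unfolding AB by (force simp: Int_commute)
  have degA: "degree T w = degree A' w + (if w = u then 1 else 0)" if "w \<in> verts A'" for w
    using degree_join(1)[OF sA dj ab that] TJ by simp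
  have degB: "degree T w = degree B' w + (if w = v then 1 else 0)" if "w \<in> verts B'" for w
    using degree_join(2)[OF sA(2,1) _ ab(2,1) that] dj TJ by (simp add: Int_commute)
  have "\<forall>w\<in>verts A' - {u}. degree A' w \<noteq> 2" "degree A' u = 0 \<or> degree A' u = 2"
    using degA T'(5) sub(3) ab(1) by force+
  then have "attachment A' u A"
    using sA(1) aA(1) cA(1) ab(1) AB(2) dA by (intro attachmentI) simp_all
  moreover have "\<forall>w\<in>verts B' - {v}. degree B' w \<noteq> 2" "degree B' v = 0 \<or> degree B' v = 2"
    using degB T'(5) sub(4) ab(2) by force+
  then have "attachment B' v B"
    using sA(2) aA(2) cA(2) ab(2) AB(3) dB by (intro attachmentI) simp_all
  ultimately have "tree_split T A' u A B' v B"
    using TJ dj sA ab by (simp add: tree_split_def)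
  moreover have "components H = {A, B}"
    unfolding AB by (rule components_disjoint_sum[OF tA(1) tB(1) djAB tA(2) tB(2)])
  ultimately show ?thesis by blast
qed

lemma tree_split_delete_leaf:
  assumes T: "phylo_tree Y T" and x: "x \<in> leaves T" "verts T \<noteq> {x}"
    and H: "suppresses_to (delete_vertex T x) H"
  shows "\<exists>A' a. tree_split T A' a H (point x) x (point x)"
proof -
  note T' = phylo_tree_simps[OF T]
  have xT: "x \<in> verts T" "degree T x \<le> 1" using x by (auto simp: leaves_def)
  then obtain y where "y \<in> verts T" "y \<noteq> x" using x(2) by blast
  then obtain e where e: "e \<in> edges T" "x \<in> e"
    using connected_incident_nonempty[OF T'(2) xT(1)] by blast
  obtain a where a: "e = {x, a}" "x \<noteq> a" "x \<in> verts T" "a \<in> verts T"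
    using simple_graph_edge_atE[OF T'(1) e] .
  have fin: "finite (incident T x)"
    using simple_graph_finite_edges[OF T'(1)] by (simp add: incident_def)
  have eI: "e \<in> incident T x" using e by (simp add: incident_def)
  have inc: "incident T x = {{x, a}}"
    using xT(2) eI card_le_Suc0_iff_eq[OF fin] a(1) by (auto simp: degree_def)
  define A' where "A' = delete_vertex T x"
  have A': "verts A' = verts T - {x}" "edges A' = edges T - {{x, a}}"
    by (simp_all add: A'_def delete_vertex_def inc)
  have xonly: "f = {x, a}" if "f \<in> edges T" "x \<in> f" for f
    using inc that by (auto simp: incident_def)
  have sA: "simple_graph A'" using T'(1) xonly unfolding simple_graph_def A' by blast
  have aA: "acyclic_graph A'" by (rule acyclic_graph_mono[OF T'(3)]) (auto simp: A')
  have ab: "a \<in> verts A'" using a by (simp add: A')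
  have cA: "is_connected A'"
  proof (rule is_connectedI[OF ab])
    fix v assume v: "v \<in> verts A'"
    then have r: "(adj T)\<^sup>*\<^sup>* a v" using is_connectedD[OF T'(2)] a by (simp add: A')
    let ?f = "\<lambda>z. if z = x then a else z"
    have "(adj A')\<^sup>*\<^sup>* (?f a) (?f v)"
    proof (rule rtranclp_hom[OF r])
      fix y z assume yz: "adj T y z"
      show "(adj A')\<^sup>*\<^sup>* (?f y) (?f z)"
      proof (cases "x \<in> {y, z}")
        case True
        then have "{y, z} = {x, a}" using xonly yz by (simp add: adj_def)
        then show ?thesis by (auto simp: doubleton_eq_iff)
      next
        case False
        then have "adj A' y z" using yz by (auto simp: adj_def A')
        then show ?thesis using False by auto
      qed
    qed
    moreover have "?f a = a" "?f v = v" using v by (auto simp: A')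
    ultimately show "(adj A')\<^sup>*\<^sup>* a v" by argo
  qed
  have dj: "verts A' \<inter> verts (point x) = {}" by (simp add: A')
  have TJ: "T = join A' (point x) a x"
    by (rule ugraph_eqI) (use e a xT in \<open>auto simp: A' insert_commute\<close>)
  have degA: "degree T w = degree A' w + (if w = a then 1 else 0)" if "w \<in> verts A'" for w
    using degree_join(1)[OF sA simple_graph_point dj ab _ that] TJ by simp
  have "verts A' \<subseteq> verts T" by (auto simp: A')
  then have "\<forall>w\<in>verts A' - {a}. degree A' w \<noteq> 2" "degree A' a = 0 \<or> degree A' a = 2"
    using degA T'(5) ab by force+
  then have "attachment A' a H"
    using sA aA cA ab H unfolding suppresses_to_def A'_def[symmetric]
    by (intro attachmentI) simp_all
  then show ?thesis using TJ dj sA ab by (auto simp: tree_split_def)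
qed

lemma cherry_attachment:
  assumes s: "tree_split T A' a H (point x) x (point x)" and c: "cherry T x y"
  shows "attachment_at A' a H y"
proof -
  have T: "T = join A' (point x) a x" and xA: "x \<notin> verts A'" and sA: "simple_graph A'" "a \<in> verts A'"
    and att: "attachment A' a H"
    using s by (auto simp: tree_split_def)
  have xy: "x \<noteq> y" "y \<in> verts T" using c by (auto simp: cherry_def leaves_def)
  then have yA: "y \<in> verts A'" by (simp add: T)
  from att[unfolded attachment_def attachment_at_def] show ?thesis
  proof (elim disjE exE conjE)
    assume "A' = point a" "H = point a"
    then show ?thesis using yA by (simp add: attachment_at_def)
  next
    fix u w assume H: "simple_graph H" "a \<notin> verts H" "{u, w} \<in> edges H" "A' = subdivide {u, w} a H"
    have uw: "u \<noteq> w" "u \<in> verts A'" "w \<in> verts A'"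
      using simple_graph_edgeD[OF H(1,3)] H by (auto simp: verts_subdivide)
    have "y = u \<or> y = w"
    proof (cases "T = \<lparr>verts = {x, y}, edges = {{x, y}}\<rparr>")
      case True
      then have "verts A' \<union> {x} = {x, y}" using T by (metis join_simps(1) point_simps(1) ugraph.select_convs(1))
      then have "u \<in> {x, y}" "w \<in> {x, y}" using uw by auto
      moreover have "u \<noteq> x" "w \<noteq> x" using uw xA by auto
      ultimately show ?thesis by simp
    next
      case False
      then obtain v where v: "adj T x v" "adj T y v" using c by (auto simp: cherry_def)
      have "{x, v} \<notin> edges A'" using simple_graph_edgeD(1)[OF sA(1)] xA by blast
      then have "{x, v} = {a, x}" using v(1) by (simp add: T adj_def)
      then have "v = a" using xA sA by (auto simp: doubleton_eq_iff)
      then have ya: "{y, a} \<in> edges A'" using v(2) xy by (auto simp: T adj_def doubleton_eq_iff)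
      then have "y \<noteq> a" using simple_graph_edgeD[OF sA(1)] by blast
      moreover have "{y, a} \<notin> edges H" using simple_graph_edgeD[OF H(1)] H(2) by blast
      ultimately show ?thesis using ya unfolding H edges_subdivide[OF H(3)] by (auto simp: doubleton_eq_iff)
    qed
    then have "{y, if y = u then w else u} = {u, w}" by auto
    then show ?thesis using H unfolding attachment_at_def by metis
  qed
qed

section \<open>Displaying trees and forests\<close>

lemma subtreeD:
  assumes "subtree S N"
  shows "simple_graph S" "is_connected S" "acyclic_graph S" "verts S \<subseteq> verts N" "edges S \<subseteq> edges N"
  using assms by (auto simp: subtree_def subgraph_def)

lemma subtree_mono:
  assumes "subtree S N" and "verts N \<subseteq> verts M" and "edges N \<subseteq> edges M"
  shows "subtree S M"
  using assms unfolding subtree_def subgraph_def by blast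

lemma subtree_point: "x \<in> verts N \<Longrightarrow> subtree (point x) N"
  by (simp add: subtree_def subgraph_def)

lemma subtree_subdivide_avoid:
  assumes "subtree S N" and "e \<notin> edges S"
  shows "subtree S (subdivide e n N)"
  using assms unfolding subtree_def subgraph_def by (auto simp: subdivide_def)

lemma subtree_subdivide:
  assumes "subtree S N" and "n \<notin> verts N"
  shows "subtree (subdivide e n S) (subdivide e n N)"
proof (cases "e \<in> edges S")
  case True
  note S = subtreeD[OF assms(1)]
  have n: "n \<notin> verts S" using S assms(2) by auto
  have "e \<in> edges N" using True S by auto
  then have "verts (subdivide e n S) \<subseteq> verts (subdivide e n N)"
    and "edges (subdivide e n S) \<subseteq> edges (subdivide e n N)"
    using True S(4,5) by (auto simp: subdivide_def)
  then show ?thesis unfolding subtree_def subgraph_def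
    using simple_graph_subdivide[OF S(1) n] is_connected_subdivide[OF S(1) n S(2)]
      acyclic_graph_subdivide_iff[OF S(1) n] S(3) by simp
qed (use assms subtree_subdivide_avoid in \<open>simp add: subdivide_id\<close>)

lemma subtree_join:
  assumes "subtree S1 N" and "subtree S2 N" and "verts S1 \<inter> verts S2 = {}"
    and "a \<in> verts S1" and "b \<in> verts S2" and "{a, b} \<in> edges N"
  shows "subtree (join S1 S2 a b) N"
proof -
  note S1 = subtreeD[OF assms(1)] and S2 = subtreeD[OF assms(2)]
  have "a \<noteq> b" using assms(3-5) by auto
  then have "simple_graph (join S1 S2 a b)" using S1 S2 assms(4,5) by (intro simple_graph_join) auto
  moreover have "verts (join S1 S2 a b) \<subseteq> verts N" "edges (join S1 S2 a b) \<subseteq> edges N"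
    using S1 S2 assms(6) by auto
  ultimately show ?thesis unfolding subtree_def subgraph_def
    using is_connected_join[OF S1(2) S2(2) assms(4,5)]
      acyclic_graph_join[OF S1(1) S2(1) assms(3-5) S1(3) S2(3)] by simp
qed

lemma displayed_viaE:
  assumes "displayed_via N S T"
  obtains H f where "subtree S N" "suppress_step\<^sup>*\<^sup>* S H" "simple_graph H" "graph_iso f H T"
    "leaves T \<subseteq> verts H" "\<forall>y\<in>leaves T. f y = y"
proof -
  obtain H f where "subtree S N" "suppress_step\<^sup>*\<^sup>* S H" "graph_iso f H T"
    "leaves T \<subseteq> verts H" "\<forall>y\<in>leaves T. f y = y"
    using assms unfolding displayed_via_def suppresses_to_def iso_fixing_def graph_iso_def by auto
  moreover from this have "simple_graph H" using suppress_steps_tree subtreeD by blast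
  ultimately show thesis using that by blast
qed

lemma displayed_viaI:
  assumes "subtree S N" and "suppress_step\<^sup>*\<^sup>* S H" and "graph_iso f H T"
    and "leaves T \<subseteq> verts H" and "\<forall>y\<in>leaves T. f y = y"
    and "\<forall>v\<in>verts T. degree T v \<noteq> 2"
  shows "displayed_via N S T"
proof -
  have "simple_graph H" using suppress_steps_tree[OF assms(2)] subtreeD[OF assms(1)] by blast
  moreover have "f v \<in> verts T" if "v \<in> verts H" for v
    using assms(3) that by (auto simp: graph_iso_def bij_betw_def)
  ultimately have "\<forall>v\<in>verts H. degree H v \<noteq> 2"
    using graph_iso_degree[OF _ assms(3)] assms(6) by metis
  then show ?thesis using assms unfolding displayed_via_def suppresses_to_def iso_fixing_def graph_iso_def
    by blast
qed

lemma displayed_via_mono: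
  assumes "displayed_via N S T" and "verts N \<subseteq> verts M" and "edges N \<subseteq> edges M"
  shows "displayed_via M S T"
  using assms subtree_mono unfolding displayed_via_def by metis

lemma displayed_via_subdivide:
  assumes "displayed_via N S T" and "n \<notin> verts N"
  shows "displayed_via (subdivide e n N) (subdivide e n S) T"
proof -
  obtain H where H: "subtree S N" "suppresses_to S H" "iso_fixing (leaves T) H T"
    using assms(1) by (auto simp: displayed_via_def)
  have "n \<notin> verts S" using subtreeD[OF H(1)] assms(2) by auto
  then have "suppress_step\<^sup>*\<^sup>* (subdivide e n S) S"
    using suppress_step_subdivide[of S n e] subtreeD(1)[OF H(1)]
    by (cases "e \<in> edges S") (auto simp: subdivide_id)
  then have "suppresses_to (subdivide e n S) H"
    using H(2) unfolding suppresses_to_def by (metis rtranclp_trans)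
  then show ?thesis using H subtree_subdivide[OF H(1) assms(2)] unfolding displayed_via_def by blast
qed

lemma displayed_via_point: "x \<in> verts N \<Longrightarrow> displayed_via N (point x) (point x)"
  by (rule displayed_viaI[of _ _ "point x" "\<lambda>x. x"])
    (auto simp: subtree_point graph_iso_def)

lemma displayed_via_pointD:
  assumes "displayed_via N S (point a)"
  shows "S = point a"
proof -
  obtain H f where H: "subtree S N" "suppress_step\<^sup>*\<^sup>* S H" "graph_iso f H (point a)"
    "leaves (point a) \<subseteq> verts H" by (rule displayed_viaE[OF assms])
  have e: "edges H = {}" using H(3) by (simp add: graph_iso_def)
  have "bij_betw f (verts H) {a}" "a \<in> verts H" using H(3,4) by (auto simp: graph_iso_def)
  moreover from this have "x = a" if "x \<in> verts H" for x
    using that bij_betwE[of f "verts H"] by (metis bij_betw_imp_inj_on inj_onD singletonD)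
  ultimately have "verts H = {a}" by blast
  then have "H = point a" using e by (intro ugraph_eqI) auto
  then show ?thesis using suppress_steps_edgeless[OF H(2) e] by simp
qed

text \<open>\<open>S\<close> becomes a subdivision of \<open>A\<close> once something is attached to \<open>n\<close>, and \<open>n\<close> plays the role of
  \<open>a\<close>. If \<open>A\<close> is the single vertex \<open>a\<close>, then \<open>n\<close> may also lie on the edge that is attached to \<open>a\<close>.\<close>

definition realises :: "'v ugraph \<Rightarrow> 'v \<Rightarrow> 'v ugraph \<Rightarrow> 'v \<Rightarrow> 'v set \<Rightarrow> bool" where
  "realises S n A a Y \<longleftrightarrow>
     (\<exists>H f. suppress_step\<^sup>*\<^sup>* S H \<and> simple_graph H \<and> n \<in> verts H \<and> graph_iso f H A \<and> f n = a \<and>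
        Y \<subseteq> verts H \<and> (\<forall>y\<in>Y. f y = y)) \<or>
     A = point a \<and> n \<noteq> a \<and> S = join (point a) (point n) a n \<and> Y = {a}"

lemma realises_point: "realises (point x) x (point x) x {x}"
  unfolding realises_def by (rule disjI1, rule exI[of _ "point x"], rule exI[of _ "\<lambda>x. x"])
    (simp add: graph_iso_def)

lemma realises_subdivide:
  assumes d: "displayed_via N S A" and "{u, w} \<in> edges A" and "a \<notin> verts A" and "n \<notin> verts N"
  shows "\<exists>e\<in>edges S. realises (subdivide e n S) n (subdivide {u, w} a A) a (leaves A) \<and>
           (u \<in> leaves A \<longrightarrow> u \<in> e)"
proof -
  obtain H f where H: "subtree S N" "suppress_step\<^sup>*\<^sup>* S H" "simple_graph H" "graph_iso f H A"
    and Y: "leaves A \<subseteq> verts H" "\<forall>y\<in>leaves A. f y = y" by (rule displayed_viaE[OF d])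
  note S = subtreeD[OF H(1)]
  have n: "n \<notin> verts S" "n \<notin> verts H" using S assms(4) suppress_steps_verts[OF H(2)] by auto
  have inj: "inj_on f (verts H)" using H(4) by (auto simp: graph_iso_def bij_betw_def)
  obtain e0 where e0: "e0 \<in> edges H" "f ` e0 = {u, w}"
    using assms(2) H(4) by (auto simp: graph_iso_def)
  obtain p where p: "p \<in> e0" "f p = u" using e0(2) by (metis image_iff insertI1)
  obtain q where q: "e0 = {p, q}" by (rule simple_graph_edge_atE[OF H(3) e0(1) p(1)])
  have pq: "{p, q} \<in> edges H" "f p = u" "f q = w"
    using e0 p q by (auto simp: doubleton_eq_iff)
  obtain e where e: "e \<in> edges S" "p \<in> e" "suppress_step\<^sup>*\<^sup>* (subdivide e n S) (subdivide {p, q} n H)"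
    using suppress_steps_lift_subdivide[OF H(2) S(1,3) pq(1) n(1)] by blast
  have "graph_iso (f(n := a)) (subdivide {p, q} n H) (subdivide {u, w} a A)"
    using graph_iso_subdivide[OF H(3,4) pq(1) n(2) assms(3)] pq by simp
  then have "realises (subdivide e n S) n (subdivide {u, w} a A) a (leaves A)"
    unfolding realises_def using e(3) simple_graph_subdivide[OF H(3) n(2)] Y n(2) pq(1)
    by (intro disjI1 exI[of _ "subdivide {p, q} n H"] exI[of _ "f(n := a)"])
      (auto simp: verts_subdivide)
  moreover have "u = p" if "u \<in> leaves A"
    using that Y pq inj simple_graph_edgeD[OF H(3) pq(1)] by (metis inj_onD subsetD)
  ultimately show ?thesis using e by blast
qed

lemma suppress_step_join_edge:
  assumes "a \<noteq> n" and "n \<noteq> m" and "a \<noteq> m" and "a \<notin> verts S" and "n \<notin> verts S" and "simple_graph S"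
  shows "suppress_step (join (join (point a) (point n) a n) S n m) (join (point a) S a m)"
proof (rule suppress_stepI[of n _ a m])
  have nn: "\<And>f. f \<in> edges S \<Longrightarrow> n \<notin> f \<and> a \<notin> f" using assms by (auto simp: simple_graph_def)
  show "incident (join (join (point a) (point n) a n) S n m) n = {{a, n}, {n, m}}"
    using nn by (auto simp: incident_def)
  have "edges S - {{a, n}, {n, m}} = edges S" using nn by auto
  then have "insert {n, m} (insert {a, n} (edges S)) - {{a, n}, {n, m}} = edges S"
    by blast
  then show "join (point a) S a m = \<lparr>verts = verts (join (join (point a) (point n) a n) S n m) - {n},
     edges = edges (join (join (point a) (point n) a n) S n m) - {{a, n}, {n, m}} \<union> {{a, m}}\<rparr>"
    using assms by (intro ugraph_eqI) auto
qed (use assms in auto)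

lemma realises_join:
  assumes "realises S1 n1 A a Y1" and "realises S2 n2 B b Y2"
    and "simple_graph S1" and "simple_graph S2" and "verts S1 \<inter> verts S2 = {}"
    and "n1 \<in> verts S1" and "n2 \<in> verts S2" and "verts A \<inter> verts B = {}"
  shows "\<exists>H f. suppress_step\<^sup>*\<^sup>* (join S1 S2 n1 n2) H \<and> graph_iso f H (join A B a b) \<and>
           Y1 \<union> Y2 \<subseteq> verts H \<and> (\<forall>y\<in>Y1 \<union> Y2. f y = y)"
proof -
  text \<open>First get rid of the extra vertices \<open>n1\<close>, \<open>n2\<close> on edges attached to single vertices.\<close>
  have reduce: "\<exists>S n H f. suppress_step\<^sup>*\<^sup>* (join S1 S2 n1 n2) (join S S2 n n2) \<and> simple_graph S \<and>
      n \<in> verts S \<and> verts S \<subseteq> verts S1 \<and>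
      suppress_step\<^sup>*\<^sup>* S H \<and> simple_graph H \<and> n \<in> verts H \<and> graph_iso f H A \<and> f n = a \<and>
      Y1 \<subseteq> verts H \<and> (\<forall>y\<in>Y1. f y = y)"
    if r: "realises S1 n1 A a Y1" and S1: "simple_graph S1" "n1 \<in> verts S1"
      and S2: "simple_graph S2" "n2 \<in> verts S2" "verts S1 \<inter> verts S2 = {}" for S1 n1 and A :: "'a ugraph" and a Y1 S2 n2
    using r unfolding realises_def
  proof (elim disjE)
    assume "\<exists>H f. suppress_step\<^sup>*\<^sup>* S1 H \<and> simple_graph H \<and> n1 \<in> verts H \<and> graph_iso f H A \<and> f n1 = a \<and>
        Y1 \<subseteq> verts H \<and> (\<forall>y\<in>Y1. f y = y)"
    then show ?thesis using S1 by blast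
  next
    assume p: "A = point a \<and> n1 \<noteq> a \<and> S1 = join (point a) (point n1) a n1 \<and> Y1 = {a}"
    then have "suppress_step (join S1 S2 n1 n2) (join (point a) S2 a n2)"
      using suppress_step_join_edge[of a n1 n2 S2] S2 by auto
    then show ?thesis using p
      by (intro exI[of _ "point a"] exI[of _ a] exI[of _ "\<lambda>x. x"] conjI)
        (auto simp: graph_iso_def)
  qed
  obtain S n H f where 1: "suppress_step\<^sup>*\<^sup>* (join S1 S2 n1 n2) (join S S2 n n2)"
    "simple_graph S" "n \<in> verts S" "verts S \<subseteq> verts S1" "suppress_step\<^sup>*\<^sup>* S H" "simple_graph H"
    "n \<in> verts H" "graph_iso f H A" "f n = a" "Y1 \<subseteq> verts H" "\<forall>y\<in>Y1. f y = y"
    using reduce[OF assms(1,3,6,4,7,5)] by blast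
  have dj: "verts S2 \<inter> verts S = {}" using 1(4) assms(5) by auto
  obtain S' m K g where 2: "suppress_step\<^sup>*\<^sup>* (join S2 S n2 n) (join S' S m n)"
    "simple_graph S'" "m \<in> verts S'" "verts S' \<subseteq> verts S2" "suppress_step\<^sup>*\<^sup>* S' K" "simple_graph K"
    "m \<in> verts K" "graph_iso g K B" "g m = b" "Y2 \<subseteq> verts K" "\<forall>y\<in>Y2. g y = y"
    using reduce[OF assms(2,4,7) 1(2,3) dj] by blast
  have dj': "verts S \<inter> verts S' = {}" using dj 2(4) by auto
  have sub: "verts H \<subseteq> verts S" "verts K \<subseteq> verts S'"
    using 1(5) 2(5) suppress_steps_verts by blast+
  have es: "\<Union> (edges S') \<subseteq> verts S'" "\<Union> (edges H) \<subseteq> verts H"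
    using 2(2) 1(6) by (auto simp: simple_graph_def)
  have "insert n (verts S') \<inter> verts S \<subseteq> verts H" "\<Union> (insert {n, m} (edges S')) \<subseteq> insert n (verts S')"
    using 1(7) 2(3) dj' es by auto
  from suppress_steps_union[OF 1(5) this]
  have "suppress_step\<^sup>*\<^sup>* (join S S' n m) (join H S' n m)"
    using 1(3,7) by (simp add: join_def insert_absorb)
  moreover have "insert m (verts H) \<inter> verts S' \<subseteq> verts K" "\<Union> (insert {m, n} (edges H)) \<subseteq> insert m (verts H)"
    using 2(7) 1(7) sub dj' es by auto
  from suppress_steps_union[OF 2(5) this]
  have "suppress_step\<^sup>*\<^sup>* (join S' H m n) (join K H m n)"
    using 2(3,7) by (simp add: join_def insert_absorb)
  ultimately have "suppress_step\<^sup>*\<^sup>* (join S1 S2 n1 n2) (join H K n m)"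
    using 1(1) 2(1) unfolding join_commute[of S2] join_commute[of S'] join_commute[of K] by (meson rtranclp_trans)
  moreover have djHK: "verts H \<inter> verts K = {}" using sub dj' by auto
  then have "graph_iso (\<lambda>v. if v \<in> verts H then f v else g v) (join H K n m) (join A B a b)"
    using graph_iso_join[OF 1(6) 2(6) 1(8) 2(8) _ assms(8) 1(7) 2(7)] 1(9) 2(9) by simp
  moreover have "\<forall>y\<in>Y1 \<union> Y2. (if y \<in> verts H then f y else g y) = y"
    using 1(10,11) 2(10,11) djHK by auto
  moreover have "Y1 \<union> Y2 \<subseteq> verts (join H K n m)" using 1(10) 2(10) by auto
  ultimately show ?thesis by blast
qed

lemma displayed_via_join:
  assumes T: "phylo_tree Y T" and sp: "tree_split T A' a A B' b B"
    and S1: "subtree S1 M" "n1 \<in> verts S1" "realises S1 n1 A' a (leaves A)"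
    and S2: "subtree S2 M" "n2 \<in> verts S2" "realises S2 n2 B' b (leaves B)"
    and dj: "verts S1 \<inter> verts S2 = {}" and e: "{n1, n2} \<in> edges M"
  shows "displayed_via M (join S1 S2 n1 n2) T"
proof -
  have T': "T = join A' B' a b" "verts A' \<inter> verts B' = {}" using sp by (auto simp: tree_split_def)
  obtain H f where H: "suppress_step\<^sup>*\<^sup>* (join S1 S2 n1 n2) H" "graph_iso f H (join A' B' a b)"
    "leaves A \<union> leaves B \<subseteq> verts H" "\<forall>y\<in>leaves A \<union> leaves B. f y = y"
    using realises_join[OF S1(3) S2(3) subtreeD(1)[OF S1(1)] subtreeD(1)[OF S2(1)] dj S1(2) S2(2) T'(2)]
    by blast
  have "\<forall>v\<in>verts T. degree T v \<noteq> 2" using phylo_tree_simps(5)[OF T] by fastforce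
  then show ?thesis
    using displayed_viaI[OF subtree_join[OF S1(1) S2(1) dj S1(2) S2(2) e] H(1), of f T] H(2-4)
      tree_split_leaves[OF sp] T'(1) by simp
qed

lemma attach_realises:
  assumes d: "displayed_via N S A" and att: "attachment_at A' a A u" and n: "n \<notin> verts N"
    and sN: "simple_graph N" and pe: "A = point a \<Longrightarrow> \<exists>e\<in>edges N. a \<in> e"
  shows "\<exists>e S'. e \<in> edges N \<and> subtree S' (subdivide e n N) \<and> n \<in> verts S' \<and>
    verts S' \<subseteq> insert n (verts S) \<and> (\<forall>f\<in>edges S'. n \<in> f \<or> f \<in> edges S) \<and>
    realises S' n A' a (leaves A) \<and> (u \<in> leaves A \<longrightarrow> u \<in> e) \<and>
    (e \<in> edges S \<or> A' = point a \<and> A = point a \<and> S = point a \<and> a \<in> e)"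
  using att[unfolded attachment_at_def]
proof (elim disjE conjE exE)
  assume A: "A' = point a" "A = point a" "u = a"
  obtain e where e: "e \<in> edges N" "a \<in> e" using pe A by blast
  obtain c where c: "e = {a, c}" "a \<noteq> c" "a \<in> verts N" "c \<in> verts N"
    using simple_graph_edge_atE[OF sN e] .
  have ac: "{a, c} \<in> edges N" using e c by simp
  have S: "S = point a" using displayed_via_pointD[of N S a] d A by simp
  have an: "a \<noteq> n" using c n by auto
  have "subtree (join (point a) (point n) a n) (subdivide e n N)"
    by (rule subtree_join) (use ac an c in \<open>auto simp: subtree_point verts_subdivide edges_subdivide\<close>)
  moreover have "realises (join (point a) (point n) a n) n A' a (leaves A)"
    using A an by (auto simp: realises_def)
  ultimately show ?thesis using e A S by (intro exI[of _ e] exI[of _ "join (point a) (point n) a n"]) auto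
next
  fix w assume A: "simple_graph A" "a \<notin> verts A" "{u, w} \<in> edges A" "A' = subdivide {u, w} a A"
  obtain e where e: "e \<in> edges S" "realises (subdivide e n S) n A' a (leaves A)" "u \<in> leaves A \<longrightarrow> u \<in> e"
    using realises_subdivide[OF d A(3,2) n] unfolding A(4) by blast
  have sub: "subtree S N" using d by (simp add: displayed_via_def)
  have "subtree (subdivide e n S) (subdivide e n N)" by (rule subtree_subdivide[OF sub n])
  moreover have "e \<in> edges N" using e subtreeD(5)[OF sub] by blast
  ultimately show ?thesis using e
    by (intro exI[of _ e] exI[of _ "subdivide e n S"]) (auto simp: verts_subdivide subdivide_def)
qed

lemma displays_forest_insert:
  assumes "displayed_via M R T"
    and "\<And>C. C \<in> F - {T} \<Longrightarrow> displayed_via M (S C) C"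
    and "\<And>C. C \<in> F - {T} \<Longrightarrow> verts (S C) \<inter> verts R = {}"
    and "\<And>C C'. C \<in> F - {T} \<Longrightarrow> C' \<in> F - {T} \<Longrightarrow> C \<noteq> C' \<Longrightarrow> verts (S C) \<inter> verts (S C') = {}"
  shows "displays_forest M F"
  unfolding displays_forest_def
proof (intro exI[of _ "S(T := R)"] conjI ballI impI)
  fix C C' assume C: "C \<in> F" "C' \<in> F" "C \<noteq> C'"
  consider "C = T" "C' \<in> F - {T}" | "C' = T" "C \<in> F - {T}" | "C \<in> F - {T}" "C' \<in> F - {T}"
    using C by blast
  then show "verts ((S(T := R)) C) \<inter> verts ((S(T := R)) C') = {}"
    using assms(3)[of C] assms(3)[of C'] assms(4)[of C C'] C by cases auto
qed (use assms in auto)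

lemma displays_forest_mono:
  assumes "displays_forest N F" and "verts N \<subseteq> verts M" and "edges N \<subseteq> edges M"
  shows "displays_forest M F"
  using assms displayed_via_mono unfolding displays_forest_def by metis

lemma displays_forest_subdivide:
  assumes "displays_forest N F" and "n \<notin> verts N"
  shows "displays_forest (subdivide e n N) F"
proof -
  obtain S where S: "\<forall>T\<in>F. displayed_via N (S T) T"
    "\<forall>T\<in>F. \<forall>T'\<in>F. T \<noteq> T' \<longrightarrow> verts (S T) \<inter> verts (S T') = {}"
    using assms(1) by (auto simp: displays_forest_def)
  show ?thesis unfolding displays_forest_def
  proof (intro exI[of _ "\<lambda>T. subdivide e n (S T)"] conjI ballI impI)
    fix T T' assume T: "T \<in> F" "T' \<in> F" "T \<noteq> T'"
    have sub: "subtree (S T) N" "subtree (S T') N" using S T by (auto simp: displayed_via_def)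
    have dj: "verts (S T) \<inter> verts (S T') = {}" using S T by blast
    have n: "n \<notin> verts (S T)" "n \<notin> verts (S T')" using sub[THEN subtreeD(4)] assms(2) by auto
    have "\<not> (e \<in> edges (S T) \<and> e \<in> edges (S T'))"
    proof
      assume e: "e \<in> edges (S T) \<and> e \<in> edges (S T')"
      obtain p q where "e = {p, q}" using simple_graph_edgeE[OF subtreeD(1)[OF sub(1)]] e by metis
      then show False using e dj simple_graph_edgeD(1)[OF subtreeD(1)[OF sub(1)]]
          simple_graph_edgeD(1)[OF subtreeD(1)[OF sub(2)]] by blast
    qed
    then show "verts (subdivide e n (S T)) \<inter> verts (subdivide e n (S T')) = {}"
      using dj n by (auto simp: subdivide_def)
  qed (use S displayed_via_subdivide[OF _ assms(2)] in blast)
qed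

section \<open>Enlarging a network\<close>

definition add_edge :: "'v ugraph \<Rightarrow> 'v \<Rightarrow> 'v \<Rightarrow> 'v ugraph" where
  "add_edge G a b = \<lparr>verts = insert a (insert b (verts G)), edges = insert {a, b} (edges G)\<rparr>"

lemma add_edge_simps [simp]:
  "verts (add_edge G a b) = insert a (insert b (verts G))"
  "edges (add_edge G a b) = insert {a, b} (edges G)"
  by (simp_all add: add_edge_def)

lemma simple_graph_add_edge: "simple_graph G \<Longrightarrow> a \<noteq> b \<Longrightarrow> simple_graph (add_edge G a b)"
  by (auto simp: simple_graph_def)

lemma is_connected_add_edge:
  assumes "is_connected G" and "a \<in> verts G"
  shows "is_connected (add_edge G a b)"
proof (rule is_connectedI[of a])
  fix v assume "v \<in> verts (add_edge G a b)"
  then consider "v \<in> verts G" | "v = b" using assms by auto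
  then show "(adj (add_edge G a b))\<^sup>*\<^sup>* a v"
  proof cases
    case 1
    show ?thesis
      by (rule rtranclp_weaken[OF is_connectedD[OF assms 1]]) (simp add: adj_def)
  next
    case 2
    then show ?thesis by (auto simp: adj_def)
  qed
qed simp

lemma phylo_networkI:
  assumes "finite X" and "X \<noteq> {}" and "simple_graph N" and "is_connected N" and "X \<subseteq> verts N"
    and "\<And>v. v \<in> X \<Longrightarrow> degree N v \<le> 1" and "\<And>v. v \<in> verts N - X \<Longrightarrow> degree N v = 3"
  shows "phylo_network X N"
proof -
  have "leaves N = X" using assms(5-7) unfolding leaves_def by force
  then show ?thesis using assms by (auto simp: phylo_network_def)
qed

lemma phylo_networkD:
  assumes "phylo_network X N"
  shows "finite X" "X \<noteq> {}" "simple_graph N" "is_connected N" "X \<subseteq> verts N"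
    and "v \<in> X \<Longrightarrow> degree N v \<le> 1" and "v \<in> verts N - X \<Longrightarrow> degree N v = 3"
  using assms by (auto simp: phylo_network_def leaves_def)

lemma phylo_network_add_leaf:
  assumes N: "phylo_network Z N" and e: "e \<in> edges N"
    and n: "n \<notin> verts N" and x: "x \<notin> verts N" "n \<noteq> x"
  shows "phylo_network (insert x Z) (add_edge (subdivide e n N) n x)"
    and "ret_number (add_edge (subdivide e n N) n x) = ret_number N"
proof -
  note N' = phylo_networkD[OF N]
  let ?G = "subdivide e n N"
  have G: "simple_graph ?G" "is_connected ?G" "verts ?G = insert n (verts N)"
    using simple_graph_subdivide[OF N'(3) n] is_connected_subdivide[OF N'(3) n N'(4)] e
    by (simp_all add: verts_subdivide)
  have xe: "\<And>f. f \<in> edges ?G \<Longrightarrow> x \<notin> f" using G(1,3) x by (auto simp: simple_graph_def)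
  then have nx: "{n, x} \<notin> edges ?G" by blast
  note fin = simple_graph_finite_edges[OF G(1)]
  have deg: "degree (add_edge ?G n x) v = (if v = n then 3 else if v = x then 1 else degree N v)" for v
  proof -
    have "incident ?G x = {}" using xe by (auto simp: incident_def)
    then have "degree ?G x = 0" by (simp add: degree_def)
    then show ?thesis
      using degree_add_edge[OF fin nx, of "add_edge ?G n x" v] degree_subdivide[OF N'(3) n e, of v] x(2)
      by auto
  qed
  show "phylo_network (insert x Z) (add_edge ?G n x)"
  proof (rule phylo_networkI)
    show "simple_graph (add_edge ?G n x)" by (rule simple_graph_add_edge[OF G(1) x(2)])
    show "is_connected (add_edge ?G n x)" using is_connected_add_edge[OF G(2)] G(3) by simp
    show "degree (add_edge ?G n x) v \<le> 1" if "v \<in> insert x Z" for v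
      using that deg[of v] N'(5,6) n x by auto
    show "degree (add_edge ?G n x) v = 3" if "v \<in> verts (add_edge ?G n x) - insert x Z" for v
      using that deg[of v] N'(7) G(3) by auto
  qed (use N'(1,5) G(3) in auto)
  have "verts (add_edge ?G n x) = insert n (insert x (verts N))" using G(3) by auto
  then have "card (verts (add_edge ?G n x)) = card (verts N) + 2"
    using N'(3) n x by (simp add: simple_graph_def)
  moreover have "card (edges (add_edge ?G n x)) = card (edges N) + 2"
    using fin nx card_subdivide(2)[OF N'(3) n e] by simp
  ultimately show "ret_number (add_edge ?G n x) = ret_number N" by (simp add: ret_number_def)
qed

lemma phylo_network_add_edge:
  assumes N: "phylo_network Z N" and e1: "e1 \<in> edges N" and e2: "e2 \<in> edges N" "e1 \<noteq> e2"
    and n1: "n1 \<notin> verts N" and n2: "n2 \<notin> verts N" "n1 \<noteq> n2"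
  shows "phylo_network Z (add_edge (subdivide e2 n2 (subdivide e1 n1 N)) n1 n2)"
    and "ret_number (add_edge (subdivide e2 n2 (subdivide e1 n1 N)) n1 n2) = ret_number N + 1"
proof -
  note N' = phylo_networkD[OF N]
  let ?G1 = "subdivide e1 n1 N"
  let ?G = "subdivide e2 n2 ?G1"
  have G1: "simple_graph ?G1" "is_connected ?G1" "verts ?G1 = insert n1 (verts N)"
    using simple_graph_subdivide[OF N'(3) n1] is_connected_subdivide[OF N'(3) n1 N'(4)] e1
    by (simp_all add: verts_subdivide)
  have n2': "n2 \<notin> verts ?G1" using n2 G1 by simp
  have e2': "e2 \<in> edges ?G1" using e1 e2 by (simp add: subdivide_def)
  have G: "simple_graph ?G" "is_connected ?G" "verts ?G = insert n2 (insert n1 (verts N))"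
    using simple_graph_subdivide[OF G1(1) n2'] is_connected_subdivide[OF G1(1) n2' G1(2)] e2' G1(3)
    by (simp_all add: verts_subdivide)
  have nn: "{n1, n2} \<notin> edges ?G"
  proof
    assume a: "{n1, n2} \<in> edges ?G"
    have "{n1, n2} \<notin> edges ?G1" using simple_graph_edgeD(2)[OF G1(1)] n2' by blast
    then obtain z where "z \<in> e2" "{n1, n2} = {z, n2}" using a e2' by (auto simp: subdivide_def)
    then have "n1 \<in> e2" by (auto simp: doubleton_eq_iff)
    then show False using e2(1) n1 N'(3) by (auto simp: simple_graph_def)
  qed
  note fin = simple_graph_finite_edges[OF G(1)]
  have deg: "degree (add_edge ?G n1 n2) v = (if v = n1 \<or> v = n2 then 3 else degree N v)" for v
    using degree_add_edge[OF fin nn, of "add_edge ?G n1 n2" v] degree_subdivide[OF N'(3) n1 e1, of v]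
      degree_subdivide[OF G1(1) n2' e2', of v] n2 by auto
  show "phylo_network Z (add_edge ?G n1 n2)"
  proof (rule phylo_networkI)
    show "simple_graph (add_edge ?G n1 n2)" by (rule simple_graph_add_edge[OF G(1) n2(2)])
    show "is_connected (add_edge ?G n1 n2)" using is_connected_add_edge[OF G(2)] G(3) by simp
    show "degree (add_edge ?G n1 n2) v \<le> 1" if "v \<in> Z" for v
      using that deg[of v] N'(5,6) n1 n2 by auto
    show "degree (add_edge ?G n1 n2) v = 3" if "v \<in> verts (add_edge ?G n1 n2) - Z" for v
      using that deg[of v] N'(7) G(3) by auto
  qed (use N'(1,2,5) G(3) in auto)
  have "verts (add_edge ?G n1 n2) = insert n1 (insert n2 (verts N))" using G(3) by auto
  then have "card (verts (add_edge ?G n1 n2)) = card (verts N) + 2"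
    using N'(3) n1 n2 by (simp add: simple_graph_def)
  moreover have "card (edges (add_edge ?G n1 n2)) = card (edges N) + 3"
    using fin nn card_subdivide(2)[OF N'(3) n1 e1] card_subdivide(2)[OF G1(1) n2' e2'] by simp
  ultimately show "ret_number (add_edge ?G n1 n2) = ret_number N + 1" by (simp add: ret_number_def)
qed

section \<open>Reversing the picking steps\<close>

lemma forest_onD:
  assumes "forest_on Y F"
  shows "finite Y" "Y \<noteq> {}" "\<Union> (leaves ` F) = Y"
    and "T \<in> F \<Longrightarrow> phylo_tree (leaves T) T" and "T \<in> F \<Longrightarrow> leaves T \<noteq> {}"
    and "T \<in> F \<Longrightarrow> T' \<in> F \<Longrightarrow> x \<in> leaves T \<Longrightarrow> x \<in> leaves T' \<Longrightarrow> T = T'"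
proof -
  have F: "finite Y \<and> Y \<noteq> {} \<and> \<Union> (leaves ` F) = Y" "\<forall>T\<in>F. phylo_tree (leaves T) T \<and> leaves T \<noteq> {}"
    "\<forall>T\<in>F. \<forall>T'\<in>F. T \<noteq> T' \<longrightarrow> leaves T \<inter> leaves T' = {}"
    using assms by (auto simp: forest_on_def phylo_tree_def phylo_network_def)
  show "finite Y" "Y \<noteq> {}" "\<Union> (leaves ` F) = Y" using F(1) by auto
  show "T \<in> F \<Longrightarrow> phylo_tree (leaves T) T" "T \<in> F \<Longrightarrow> leaves T \<noteq> {}" using F(2) by auto
  show "T \<in> F \<Longrightarrow> T' \<in> F \<Longrightarrow> x \<in> leaves T \<Longrightarrow> x \<in> leaves T' \<Longrightarrow> T = T'" using F(3) by blast
qed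

lemma displays_forestE:
  assumes "displays_forest N F"
  obtains S where "\<And>T. T \<in> F \<Longrightarrow> displayed_via N (S T) T"
    "\<And>T T'. T \<in> F \<Longrightarrow> T' \<in> F \<Longrightarrow> T \<noteq> T' \<Longrightarrow> verts (S T) \<inter> verts (S T') = {}"
proof -
  obtain S where "\<forall>T\<in>F. displayed_via N (S T) T"
    "\<forall>T\<in>F. \<forall>T'\<in>F. T \<noteq> T' \<longrightarrow> verts (S T) \<inter> verts (S T') = {}"
    using assms unfolding displays_forest_def by blast
  then show thesis by (intro that[of S]) blast+
qed

lemma minus_edgeE:
  assumes F: "forest_on Y F" and m: "minus_edge F T e G"
  obtains A' a A B' b B where "T \<in> F" "phylo_tree (leaves T) T" "tree_split T A' a A B' b B"
    "G = (F - {T}) \<union> {A, B}"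
proof -
  obtain H where H: "T \<in> F" "e \<in> edges T" "suppresses_to (delete_edge T e) H" "G = (F - {T}) \<union> components H"
    using m by (auto simp: minus_edge_def)
  show thesis using tree_split_delete_edge[OF forest_onD(4)[OF F H(1)] H(2,3)] that H forest_onD(4)[OF F H(1)]
    by metis
qed

lemma minus_leafE:
  assumes F: "forest_on Y F" and m: "minus_leaf F x G"
  obtains (single) T where "T \<in> F" "T = point x" "G = F - {T}"
  | (split) T A' a H where "T \<in> F" "phylo_tree (leaves T) T" "x \<in> leaves T" "verts T \<noteq> {x}"
      "tree_split T A' a H (point x) x (point x)" "G = (F - {T}) \<union> {H}"
proof -
  obtain T where T: "T \<in> F" "x \<in> leaves T"
    "if verts T = {x} then G = F - {T}
     else \<exists>H. suppresses_to (delete_vertex T x) H \<and> G = (F - {T}) \<union> {H}"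
    using m by (auto simp: minus_leaf_def)
  note pT = forest_onD(4)[OF F T(1)]
  show thesis
  proof (cases "verts T = {x}")
    case True
    have "edges T = {}"
      using simple_graph_edgeE[OF phylo_tree_simps(1)[OF pT]] True by (metis equals0I singletonD)
    then have "T = point x" using True by (intro ugraph_eqI) auto
    then show thesis using single[OF T(1)] T(3) True by simp
  next
    case False
    then obtain H where H: "suppresses_to (delete_vertex T x) H" "G = (F - {T}) \<union> {H}"
      using T(3) by auto
    obtain A' a where "tree_split T A' a H (point x) x (point x)"
      using tree_split_delete_leaf[OF pT T(2) False H(1)] by blast
    then show thesis using split[OF T(1) pT T(2) False _ H(2)] by blast
  qed
qed

lemma minus_edge_leaves:
  assumes F: "forest_on Y F" and m: "minus_edge F T e G"
  shows "\<Union> (leaves ` G) = Y"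
proof -
  obtain A' a A B' b B where T: "T \<in> F" "tree_split T A' a A B' b B" "G = (F - {T}) \<union> {A, B}"
    by (rule minus_edgeE[OF assms])
  have "\<Union> (leaves ` F) = \<Union> (leaves ` (F - {T})) \<union> leaves T" using T(1) by auto
  then show ?thesis using forest_onD(3)[OF F] tree_split_leaves[OF T(2)] T(3) by auto
qed

lemma minus_leaf_leaves:
  assumes F: "forest_on Y F" and m: "minus_leaf F x G"
  shows "\<Union> (leaves ` G) = Y - {x}" and "x \<in> Y"
proof -
  have dj: "x \<notin> \<Union> (leaves ` (F - {T}))" if "T \<in> F" "x \<in> leaves T" for T
    using that forest_onD(6)[OF F] by blast
  have un: "Y = \<Union> (leaves ` (F - {T})) \<union> leaves T" if "T \<in> F" for T
    using that forest_onD(3)[OF F] by auto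
  have "\<Union> (leaves ` G) = Y - {x} \<and> x \<in> Y"
  proof (cases rule: minus_leafE[OF assms])
    case (1 T)
    then show ?thesis using dj[of T] un[of T] by auto
  next
    case (2 T A' a H)
    have l: "leaves T = leaves H \<union> {x}" using tree_split_leaves[OF 2(5)] by simp
    have "x \<notin> verts A'" using 2(5) by (auto simp: tree_split_def)
    moreover have "verts H \<subseteq> verts A'"
      using 2(5) by (auto simp: tree_split_def attachment_def attachment_at_def verts_subdivide)
    ultimately have "x \<notin> leaves H" by (auto simp: leaves_def)
    then show ?thesis using dj[OF 2(1,3)] un[OF 2(1)] l 2(6) by auto
  qed
  then show "\<Union> (leaves ` G) = Y - {x}" "x \<in> Y" by auto
qed

lemma attachment_verts:
  assumes "attachment A' a A"
  shows "verts A \<subseteq> verts A'" and "verts A \<noteq> {}"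
  using assms simple_graph_edgeD(1) by (fastforce simp: attachment_def attachment_at_def verts_subdivide)+

lemma displays_minus_edge:
  assumes F: "forest_on Y F" and m: "minus_edge F T e G" and N: "phylo_network Z N"
    and G: "displays_forest N G" and n: "n1 \<notin> verts N" "n2 \<notin> verts N" "n1 \<noteq> n2"
  shows "displays_forest N F \<or> (\<exists>e1 e2. e1 \<in> edges N \<and> e2 \<in> edges N \<and> e1 \<noteq> e2 \<and>
           displays_forest (add_edge (subdivide e2 n2 (subdivide e1 n1 N)) n1 n2) F)"
proof -
  note N' = phylo_networkD[OF N]
  obtain A' a A B' b B where T: "T \<in> F" "phylo_tree (leaves T) T" "tree_split T A' a A B' b B"
    "G = (F - {T}) \<union> {A, B}" by (rule minus_edgeE[OF F m])
  obtain S where S: "\<And>C. C \<in> G \<Longrightarrow> displayed_via N (S C) C"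
    "\<And>C C'. C \<in> G \<Longrightarrow> C' \<in> G \<Longrightarrow> C \<noteq> C' \<Longrightarrow> verts (S C) \<inter> verts (S C') = {}"
    by (rule displays_forestE[OF G]) blast
  have sub: "subtree (S C) N" if "C \<in> G" for C using S(1)[OF that] by (simp add: displayed_via_def)
  have att: "attachment A' a A" "attachment B' b B" "verts A' \<inter> verts B' = {}"
    using T(3) by (auto simp: tree_split_def)
  have inG: "A \<in> G" "B \<in> G" using T(4) by auto
  have AB: "A \<noteq> B" using attachment_verts[OF att(1)] attachment_verts[OF att(2)] att(3) by blast
  have lT: "leaves T = leaves A \<union> leaves B" using tree_split_leaves[OF T(3)] .
  have other: "C \<in> G" "C \<noteq> A" "C \<noteq> B" if "C \<in> F - {T}" for C
  proof -
    show "C \<in> G" using that T(4) by blast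
    have "leaves C \<inter> leaves T = {}" "leaves C \<noteq> {}"
      using that T(1) forest_onD(5)[OF F, of C] forest_onD(6)[OF F, of C T] by blast+
    then show "C \<noteq> A" "C \<noteq> B" using lT by auto
  qed
  have djAB: "verts (S A) \<inter> verts (S B) = {}" using S(2)[OF inG AB] .
  have ne: "verts (S C) \<noteq> {}" if "C \<in> G" for C
    using subtreeD(2)[OF sub[OF that]] by (simp add: is_connected_def)
  have pend: "\<exists>e\<in>edges N. c \<in> e" if C: "C \<in> G" "C = point c" "C' \<in> G" "C \<noteq> C'" for C c C'
  proof -
    have "S C = point c" using S(1)[OF C(1)] displayed_via_pointD[of N "S C" c] C(2) by simp
    then have c: "c \<in> verts (S C)" by simp
    obtain d where d: "d \<in> verts (S C')" using ne[OF C(3)] by blast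
    have "c \<noteq> d" using c d S(2)[OF C(1,3,4)] by auto
    moreover have "c \<in> verts N" "d \<in> verts N" using c d subtreeD(4)[OF sub] C by auto
    ultimately show ?thesis using connected_incident_nonempty[OF N'(4)] by blast
  qed
  obtain u v where uv: "attachment_at A' a A u" "attachment_at B' b B v"
    using att by (auto simp: attachment_def)
  obtain e1 S1 where S1: "e1 \<in> edges N" "subtree S1 (subdivide e1 n1 N)" "n1 \<in> verts S1"
    "verts S1 \<subseteq> insert n1 (verts (S A))" "\<forall>f\<in>edges S1. n1 \<in> f \<or> f \<in> edges (S A)"
    "realises S1 n1 A' a (leaves A)"
    "e1 \<in> edges (S A) \<or> A' = point a \<and> A = point a \<and> S A = point a \<and> a \<in> e1"
    using attach_realises[OF S(1)[OF inG(1)] uv(1) n(1) N'(3)] pend[OF inG(1) _ inG(2) AB] by blast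
  obtain e2 S2 where S2: "e2 \<in> edges N" "subtree S2 (subdivide e2 n2 N)" "n2 \<in> verts S2"
    "verts S2 \<subseteq> insert n2 (verts (S B))" "\<forall>f\<in>edges S2. n2 \<in> f \<or> f \<in> edges (S B)"
    "realises S2 n2 B' b (leaves B)"
    "e2 \<in> edges (S B) \<or> B' = point b \<and> B = point b \<and> S B = point b \<and> b \<in> e2"
    using attach_realises[OF S(1)[OF inG(2)] uv(2) n(2) N'(3)] pend[OF inG(2) _ inG(1)] AB by blast
  have avoid: "f \<notin> edges (S C)" if "f \<in> edges (S D) \<or> S D = point d \<and> d \<in> f" "D \<in> G" "C \<in> G" "C \<noteq> D"
    for f C D d
  proof
    assume f: "f \<in> edges (S C)"
    note sC = subtreeD(1)[OF sub[OF that(3)]] and sD = subtreeD(1)[OF sub[OF that(2)]]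
    have "f \<subseteq> verts (S C)" "f \<noteq> {}" using sC f by (auto simp: simple_graph_def)
    moreover have "f \<inter> verts (S D) \<noteq> {}"
      using that(1) sD \<open>f \<noteq> {}\<close> by (auto simp: simple_graph_def)
    ultimately show False using S(2)[OF that(3,2,4)] by blast
  qed
  have avoid1: "e1 \<notin> edges (S C)" if "C \<in> G" "C \<noteq> A" for C using avoid[OF _ inG(1) that] S1(7) by blast
  have avoid2: "e2 \<notin> edges (S C)" if "C \<in> G" "C \<noteq> B" for C using avoid[OF _ inG(2) that] S2(7) by blast
  show ?thesis
  proof (cases "e1 = e2")
    case True
    have "A' = point a \<and> A = point a \<and> S A = point a \<and> a \<in> e1"
      using S1(7) avoid2[OF inG(1) AB] True by blast
    moreover have "B' = point b \<and> B = point b \<and> S B = point b \<and> b \<in> e1"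
      using S2(7) avoid1[OF inG(2)] AB True by blast
    ultimately have pt: "A' = point a" "A = point a" "S A = point a" "a \<in> e1"
      "B' = point b" "B = point b" "S B = point b" "b \<in> e1" by auto
    have "a \<noteq> b" using djAB pt by auto
    then have ab: "{a, b} \<in> edges N"
      using simple_graph_edge_atE[OF N'(3) S1(1) pt(4)] pt(8) S1(1)
      by (metis insert_iff singletonD)
    have "subtree (point a) N" "subtree (point b) N"
      using sub[OF inG(1)] sub[OF inG(2)] unfolding pt(3,7) by auto
    then have "displayed_via N (join (point a) (point b) a b) T"
      using ab \<open>a \<noteq> b\<close> realises_point[of a] realises_point[of b]
      by (intro displayed_via_join[OF T(2,3)]) (auto simp: pt)
    then have "displays_forest N F"
    proof (rule displays_forest_insert[where S = S])
      fix C assume C: "C \<in> F - {T}"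
      show "verts (S C) \<inter> verts (join (point a) (point b) a b) = {}"
        using S(2)[OF other(1)[OF C] inG(1) other(2)[OF C]]
          S(2)[OF other(1)[OF C] inG(2) other(3)[OF C]] unfolding pt(3,7) by auto
    qed (use other S in auto)
    then show ?thesis ..
  next
    case False
    let ?N2 = "subdivide e2 n2 (subdivide e1 n1 N)"
    let ?M = "add_edge ?N2 n1 n2"
    have comm: "?N2 = subdivide e1 n1 (subdivide e2 n2 N)"
      using subdivide_commute[OF N'(3) False n(1,2) S1(1) S2(1)] by simp
    have M: "verts ?N2 \<subseteq> verts ?M" "edges ?N2 \<subseteq> edges ?M" by auto
    have fN: "n1 \<notin> f" "n2 \<notin> f" if "f \<in> edges N" for f
      using that n N'(3) by (auto simp: simple_graph_def)
    have "e2 \<notin> edges S1" using S1(5) avoid2[OF inG(1) AB] fN(1)[OF S2(1)] by blast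
    then have "subtree S1 ?N2" by (rule subtree_subdivide_avoid[OF S1(2)])
    then have s1: "subtree S1 ?M" using subtree_mono M by blast
    have "e1 \<notin> edges S2" using S2(5) avoid1[OF inG(2)] AB fN(2)[OF S1(1)] by blast
    then have "subtree S2 ?N2" unfolding comm by (rule subtree_subdivide_avoid[OF S2(2)])
    then have s2: "subtree S2 ?M" using subtree_mono M by blast
    have vN: "verts (S C) \<subseteq> verts N" if "C \<in> G" for C using subtreeD(4)[OF sub[OF that]] .
    have dj: "verts S1 \<inter> verts S2 = {}"
      using S1(4) S2(4) djAB vN[OF inG(1)] vN[OF inG(2)] n by blast
    have "displayed_via ?M (join S1 S2 n1 n2) T"
      by (rule displayed_via_join[OF T(2,3) s1 S1(3,6) s2 S2(3,6) dj]) simp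
    then have "displays_forest ?M F"
    proof (rule displays_forest_insert[where S = S])
      fix C assume C: "C \<in> F - {T}"
      note C' = other[OF C]
      have n2': "n2 \<notin> verts (subdivide e1 n1 N)" using n verts_subdivide_subset[of e1 n1 N] by auto
      have "displayed_via (subdivide e1 n1 N) (S C) C"
        using displayed_via_subdivide[OF S(1)[OF C'(1)] n(1), of e1]
        by (simp add: subdivide_id[OF avoid1[OF C'(1,2)]])
      from displayed_via_subdivide[OF this n2', of e2] have "displayed_via ?N2 (S C) C"
        by (simp add: subdivide_id[OF avoid2[OF C'(1,3)]])
      then show "displayed_via ?M (S C) C" using displayed_via_mono M by blast
      show "verts (S C) \<inter> verts (join S1 S2 n1 n2) = {}"
        using S1(4) S2(4) S(2)[OF C'(1) inG(1) C'(2)] S(2)[OF C'(1) inG(2) C'(3)] vN[OF C'(1)] n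
        unfolding join_simps by blast
    next
      fix C C' assume "C \<in> F - {T}" "C' \<in> F - {T}" "C \<noteq> C'"
      then show "verts (S C) \<inter> verts (S C') = {}" using S(2) other(1) by blast
    qed
    then show ?thesis using S1(1) S2(1) False by blast
  qed
qed

lemma displays_minus_leaf_single:
  assumes F: "forest_on Y F" and m: "minus_leaf F x G" and T: "T \<in> F" "verts T = {x}"
    and G: "displays_forest N G" and sub: "verts N \<subseteq> verts M" "edges N \<subseteq> edges M"
    and x: "x \<in> verts M" "x \<notin> verts N"
  shows "displays_forest M F"
  using minus_leafE[OF F m]
proof cases
  case (1 T')
  obtain S where S: "\<And>C. C \<in> G \<Longrightarrow> displayed_via N (S C) C"
    "\<And>C C'. C \<in> G \<Longrightarrow> C' \<in> G \<Longrightarrow> C \<noteq> C' \<Longrightarrow> verts (S C) \<inter> verts (S C') = {}"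
    by (rule displays_forestE[OF G]) blast
  have "displayed_via M (point x) T'" using displayed_via_point[OF x(1)] 1 by simp
  then show ?thesis
  proof (rule displays_forest_insert[where S = S])
    fix C assume C: "C \<in> F - {T'}"
    then have d: "displayed_via N (S C) C" using S(1) 1 by blast
    then show "displayed_via M (S C) C" using displayed_via_mono sub by blast
    have "verts (S C) \<subseteq> verts N" using d by (auto simp: displayed_via_def dest: subtreeD)
    then show "verts (S C) \<inter> verts (point x) = {}" using x by auto
  qed (use S(2) 1 in blast)
next
  case (2 T' A' a H)
  have "leaves T \<subseteq> {x}" using T(2) by (auto simp: leaves_def)
  then have "x \<in> leaves T" using forest_onD(5)[OF F T(1)] by blast
  then have "T = T'" using forest_onD(6)[OF F T(1) 2(1)] 2(3) by blast
  then show ?thesis using 2(4) T by simp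
qed

lemma displays_minus_leaf:
  assumes F: "forest_on Y F" and m: "minus_leaf F x G" and N: "phylo_network Z N" "edges N \<noteq> {}"
    and G: "displays_forest N G" and n: "n \<notin> verts N" "x \<notin> verts N" "n \<noteq> x"
  shows "\<exists>e\<in>edges N. displays_forest (add_edge (subdivide e n N) n x) F \<and>
           (forest_cherry F x y \<longrightarrow> y \<in> e)"
  using minus_leafE[OF F m]
proof cases
  case (1 T)
  obtain e where e: "e \<in> edges N" using N(2) by blast
  have "displays_forest (add_edge (subdivide e n N) n x) F"
  proof (rule displays_minus_leaf_single[OF F m 1(1) _ displays_forest_subdivide[OF G n(1)]])
    show "x \<notin> verts (subdivide e n N)" using n verts_subdivide_subset[of e n N] by auto
  qed (use 1(2) in auto)
  moreover have "\<not> forest_cherry F x y"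
  proof
    assume "forest_cherry F x y"
    then obtain T' where T': "T' \<in> F" "x \<in> leaves T'" "y \<in> leaves T'" "x \<noteq> y"
      by (auto simp: forest_cherry_def cherry_def)
    then have "T' = T" using forest_onD(6)[OF F T'(1) 1(1) T'(2)] 1(2) by simp
    then show False using T' 1(2) by simp
  qed
  ultimately show ?thesis using e by blast
next
  case (2 T A' a H)
  note N' = phylo_networkD[OF N(1)]
  obtain S where S: "\<And>C. C \<in> G \<Longrightarrow> displayed_via N (S C) C"
    "\<And>C C'. C \<in> G \<Longrightarrow> C' \<in> G \<Longrightarrow> C \<noteq> C' \<Longrightarrow> verts (S C) \<inter> verts (S C') = {}"
    by (rule displays_forestE[OF G]) blast
  have sub: "subtree (S C) N" if "C \<in> G" for C using S(1)[OF that] by (simp add: displayed_via_def)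
  have H: "H \<in> G" using 2(6) by simp
  have lT: "leaves T = leaves H \<union> {x}" using tree_split_leaves[OF 2(5)] by simp
  have att: "attachment A' a H" using 2(5) by (simp add: tree_split_def)
  have cherry: "attachment_at A' a H y \<and> y \<in> leaves H" if "forest_cherry F x y"
  proof -
    obtain T' where T': "T' \<in> F" "cherry T' x y" using \<open>forest_cherry F x y\<close> by (auto simp: forest_cherry_def)
    then have "x \<in> leaves T'" "y \<in> leaves T'" "x \<noteq> y" by (auto simp: cherry_def)
    then have "T' = T" using forest_onD(6)[OF F T'(1) 2(1) _ 2(3)] by blast
    then show ?thesis
      using cherry_attachment[OF 2(5)] T'(2) lT \<open>y \<in> leaves T'\<close> \<open>x \<noteq> y\<close> by auto
  qed
  obtain u where u: "attachment_at A' a H u" "forest_cherry F x y \<longrightarrow> u = y"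
    using att cherry unfolding attachment_def by blast
  have pend: "\<exists>e\<in>edges N. a \<in> e" if "H = point a"
  proof -
    have "S H = point a" using S(1)[OF H] displayed_via_pointD[of N "S H" a] that by simp
    then have a: "a \<in> verts N" using subtreeD(4)[OF sub[OF H]] by simp
    obtain p q where "p \<in> verts N" "q \<in> verts N" "p \<noteq> q"
      using N(2) simple_graph_edgeE[OF N'(3)] by (metis all_not_in_conv)
    then show ?thesis using connected_incident_nonempty[OF N'(4) a] by metis
  qed
  obtain e S' where e: "e \<in> edges N" "subtree S' (subdivide e n N)" "n \<in> verts S'"
    "verts S' \<subseteq> insert n (verts (S H))" "realises S' n A' a (leaves H)" "u \<in> leaves H \<longrightarrow> u \<in> e"
    "e \<in> edges (S H) \<or> A' = point a \<and> H = point a \<and> S H = point a \<and> a \<in> e"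
    using attach_realises[OF S(1)[OF H] u(1) n(1) N'(3) pend] by blast
  have other: "C \<in> G" "C \<noteq> H" if "C \<in> F - {T}" for C
  proof -
    show "C \<in> G" using that 2(6) by blast
    have "leaves C \<inter> leaves T = {}" "leaves C \<noteq> {}"
      using that 2(1) forest_onD(5)[OF F, of C] forest_onD(6)[OF F, of C T] by blast+
    then show "C \<noteq> H" using lT by auto
  qed
  have avoid: "e \<notin> edges (S C)" if "C \<in> G" "C \<noteq> H" for C
  proof
    assume f: "e \<in> edges (S C)"
    note sC = subtreeD(1)[OF sub[OF that(1)]] and sH = subtreeD(1)[OF sub[OF H]]
    have "e \<subseteq> verts (S C)" "e \<noteq> {}" using sC f by (auto simp: simple_graph_def)
    moreover have "e \<inter> verts (S H) \<noteq> {}"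
      using e(7) sH \<open>e \<noteq> {}\<close> by (auto simp: simple_graph_def)
    ultimately show False using S(2)[OF that(1) H that(2)] by blast
  qed
  let ?N1 = "subdivide e n N"
  let ?M = "add_edge ?N1 n x"
  have M: "verts ?N1 \<subseteq> verts ?M" "edges ?N1 \<subseteq> edges ?M" by auto
  have vN: "verts (S C) \<subseteq> verts N" if "C \<in> G" for C using subtreeD(4)[OF sub[OF that]] .
  have dj: "verts S' \<inter> verts (point x) = {}" using e(4) vN[OF H] n unfolding point_simps by blast
  have rx: "realises (point x) x (point x) x (leaves (point x))" using realises_point[of x] by simp
  have px: "subtree (point x) ?M" by (rule subtree_point) simp
  have "displayed_via ?M (join S' (point x) n x) T"
    by (rule displayed_via_join[OF 2(2,5) subtree_mono[OF e(2) M] e(3,5) px _ rx dj]) auto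
  then have "displays_forest ?M F"
  proof (rule displays_forest_insert[where S = S])
    fix C assume C: "C \<in> F - {T}"
    note C' = other[OF C]
    have "displayed_via ?N1 (S C) C"
      using displayed_via_subdivide[OF S(1)[OF C'(1)] n(1), of e]
      by (simp add: subdivide_id[OF avoid[OF C']])
    then show "displayed_via ?M (S C) C" using displayed_via_mono M by blast
    show "verts (S C) \<inter> verts (join S' (point x) n x) = {}"
      using e(4) S(2)[OF C'(1) H C'(2)] vN[OF C'(1)] n unfolding join_simps point_simps by blast
  next
    fix C C' assume "C \<in> F - {T}" "C' \<in> F - {T}" "C \<noteq> C'"
    then show "verts (S C) \<inter> verts (S C') = {}" using S(2) other(1) by blast
  qed
  moreover have "y \<in> e" if "forest_cherry F x y" using that cherry u(2) e(6) by blast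
  ultimately show ?thesis using e(1) by blast
qed

lemma displays_minus_leaf_point:
  assumes F: "forest_on Y F" and m: "minus_leaf F x G"
    and G: "displays_forest (point z) G" and x: "x \<noteq> z"
  shows "displays_forest (add_edge (point z) z x) F"
  using minus_leafE[OF F m]
proof cases
  case (1 T)
  show ?thesis
    by (rule displays_minus_leaf_single[OF F m 1(1) _ G]) (use 1(2) x in auto)
next
  case (2 T A' a H)
  let ?M = "add_edge (point z) z x"
  have M: "verts (point z) \<subseteq> verts ?M" "edges (point z) \<subseteq> edges ?M" by auto
  obtain S where S: "\<And>C. C \<in> G \<Longrightarrow> displayed_via (point z) (S C) C"
    "\<And>C C'. C \<in> G \<Longrightarrow> C' \<in> G \<Longrightarrow> C \<noteq> C' \<Longrightarrow> verts (S C) \<inter> verts (S C') = {}"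
    by (rule displays_forestE[OF G]) blast
  have sub: "subtree (S C) (point z)" if "C \<in> G" for C
    using S(1)[OF that] by (simp add: displayed_via_def)
  have H: "H \<in> G" using 2(6) by simp
  have lT: "leaves T = leaves H \<union> {x}" using tree_split_leaves[OF 2(5)] by simp
  have "attachment A' a H" using 2(5) by (simp add: tree_split_def)
  then have pt: "A' = point a" "H = point a"
  proof -
    have "A' = point a \<and> H = point a"
      using \<open>attachment A' a H\<close>[unfolded attachment_def attachment_at_def]
    proof (elim exE disjE conjE)
      fix u w assume *: "a \<notin> verts H" "{u, w} \<in> edges H"
      have "x \<notin> verts (point z)" using x by simp
      from realises_subdivide[OF S(1)[OF H] *(2,1) this] subtreeD(5)[OF sub[OF H]]
      show ?thesis by auto
    qed simp
    then show "A' = point a" "H = point a" by auto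
  qed
  have SH: "S H = point a" using S(1)[OF H] displayed_via_pointD[of "point z" "S H" a] pt by simp
  then have az: "a = z" using subtreeD(4)[OF sub[OF H]] by simp
  have other: "C \<in> G" "C \<noteq> H" if "C \<in> F - {T}" for C
  proof -
    show "C \<in> G" using that 2(6) by blast
    have "leaves C \<inter> leaves T = {}" "leaves C \<noteq> {}"
      using that 2(1) forest_onD(5)[OF F, of C] forest_onD(6)[OF F, of C T] by blast+
    then show "C \<noteq> H" using lT by auto
  qed
  have "displayed_via ?M (join (point z) (point x) z x) T"
    using realises_point[of z] realises_point[of x] x
    by (intro displayed_via_join[OF 2(2,5)]) (auto simp: pt az subtree_point)
  then show ?thesis
  proof (rule displays_forest_insert[where S = S])
    fix C assume C: "C \<in> F - {T}"
    note C' = other[OF C]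
    show "displayed_via ?M (S C) C" by (rule displayed_via_mono[OF S(1)[OF C'(1)] M])
    show "verts (S C) \<inter> verts (join (point z) (point x) z x) = {}"
      using S(2)[OF C'(1) H C'(2)] subtreeD(4)[OF sub[OF C'(1)]] SH az x by auto
  next
    fix C C' assume "C \<in> F - {T}" "C' \<in> F - {T}" "C \<noteq> C'"
    then show "verts (S C) \<inter> verts (S C') = {}" using S(2) other(1) by blast
  qed
qed

lemma network_minus_edge:
  fixes N :: "'v::infinite ugraph"
  assumes F: "forest_on Y F" and m: "minus_edge F T e G" and N: "phylo_network Y N"
    and d: "displays_forest N G" "displays_forest N F'" and Q: "finite Q" "verts N \<inter> Q = {}"
  shows "\<exists>M. phylo_network Y M \<and> displays_forest M F \<and> displays_forest M F' \<and>
           ret_number M \<le> ret_number N + 1 \<and> verts M \<inter> Q = {}"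
proof -
  have fin: "finite (verts N \<union> Q)" using phylo_networkD(3)[OF N] Q(1) by (simp add: simple_graph_def)
  obtain n1 where n1: "n1 \<notin> verts N \<union> Q" using ex_new_if_finite[OF infinite_UNIV fin] by blast
  obtain n2 where n2: "n2 \<notin> insert n1 (verts N \<union> Q)"
    using ex_new_if_finite[OF infinite_UNIV, of "insert n1 (verts N \<union> Q)"] fin by auto
  have n: "n1 \<notin> verts N" "n2 \<notin> verts N" "n1 \<noteq> n2" using n1 n2 by auto
  consider "displays_forest N F"
    | e1 e2 where "e1 \<in> edges N" "e2 \<in> edges N" "e1 \<noteq> e2"
        "displays_forest (add_edge (subdivide e2 n2 (subdivide e1 n1 N)) n1 n2) F"
    using displays_minus_edge[OF F m N d(1) n] by blast
  then show ?thesis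
  proof cases
    case 1
    then show ?thesis using N d Q by (intro exI[of _ N]) auto
  next
    case 2
    let ?M = "add_edge (subdivide e2 n2 (subdivide e1 n1 N)) n1 n2"
    have v: "verts ?M \<subseteq> insert n1 (insert n2 (verts N))"
      using verts_subdivide_subset[of e2 n2] verts_subdivide_subset[of e1 n1] by fastforce
    have n2': "n2 \<notin> verts (subdivide e1 n1 N)" using n verts_subdivide_subset[of e1 n1 N] by auto
    have "displays_forest (subdivide e2 n2 (subdivide e1 n1 N)) F'"
      by (intro displays_forest_subdivide d(2) n n2')
    then have "displays_forest ?M F'" by (rule displays_forest_mono) auto
    moreover have "verts ?M \<inter> Q = {}" using v n1 n2 Q(2) by blast
    ultimately show ?thesis
      using 2(4) phylo_network_add_edge[OF N 2(1,2,3) n] by (intro exI[of _ ?M]) auto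
  qed
qed

lemma phylo_network_single_edge:
  assumes "x \<noteq> z"
  shows "phylo_network {x, z} (add_edge (point z) z x)" and "ret_number (add_edge (point z) z x) = 0"
proof -
  have "degree (add_edge (point z) z x) v = (if v = z \<or> v = x then 1 else 0)" for v
    using degree_add_edge[of "point z" z x "add_edge (point z) z x" v] by simp
  then show "phylo_network {x, z} (add_edge (point z) z x)"
    using assms by (intro phylo_networkI simple_graph_add_edge is_connected_add_edge) auto
  show "ret_number (add_edge (point z) z x) = 0"
    using assms by (simp add: ret_number_def insert_commute)
qed

lemma phylo_network_edgeless:
  assumes N: "phylo_network Z N" and "edges N = {}"
  obtains z where "N = point z" "Z = {z}"
proof -
  note N' = phylo_networkD[OF N]
  obtain z where z: "z \<in> Z" using N'(2) by blast
  have "degree N z = 0" using assms(2) by (simp add: degree_def incident_def)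
  then have "N = point z" using connected_single[OF N'(3,4)] z N'(5) by blast
  then show thesis using that z N'(5) by auto
qed

lemma network_minus_leaf:
  fixes N :: "'v::infinite ugraph"
  assumes F: "forest_on Y F" "forest_on Y F'" and m: "minus_leaf F x G" "minus_leaf F' x G'"
    and c: "(\<exists>y. forest_cherry F x y \<and> forest_cherry F' x y) \<or> (\<exists>T\<in>F. verts T = {x})"
    and N: "phylo_network (Y - {x}) N" and d: "displays_forest N G" "displays_forest N G'"
    and Q: "finite Q" "verts N \<inter> Q = {}" "x \<notin> Q" "x \<notin> verts N"
  shows "\<exists>M. phylo_network Y M \<and> displays_forest M F \<and> displays_forest M F' \<and>
           ret_number M = ret_number N \<and> verts M \<inter> Q = {}"
proof -
  note N' = phylo_networkD[OF N]
  have xY: "x \<in> Y" using minus_leaf_leaves(2)[OF F(1) m(1)] .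
  show ?thesis
  proof (cases "edges N = {}")
    case True
    obtain z where z: "N = point z" "Y - {x} = {z}" by (rule phylo_network_edgeless[OF N True])
    have "x \<noteq> z" using Q(4) z by simp
    have Y: "Y = {x, z}" using z(2) xY by blast
    have "phylo_network Y (add_edge (point z) z x)" "ret_number (add_edge (point z) z x) = ret_number N"
      using phylo_network_single_edge[OF \<open>x \<noteq> z\<close>] by (simp_all add: Y z(1) ret_number_def)
    moreover have "displays_forest (add_edge (point z) z x) F" "displays_forest (add_edge (point z) z x) F'"
      using displays_minus_leaf_point[OF F(1) m(1) _ \<open>x \<noteq> z\<close>]
        displays_minus_leaf_point[OF F(2) m(2) _ \<open>x \<noteq> z\<close>] d z(1) by simp_all
    ultimately show ?thesis using Q z(1) by (intro exI[of _ "add_edge (point z) z x"]) auto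
  next
    case False
    have fin: "finite (insert x (verts N \<union> Q))" using N'(3) Q(1) by (simp add: simple_graph_def)
    obtain n where n: "n \<notin> insert x (verts N \<union> Q)" using ex_new_if_finite[OF infinite_UNIV fin] by blast
    then have n': "n \<notin> verts N" "x \<notin> verts N" "n \<noteq> x" using Q by auto
    have "\<exists>e\<in>edges N. displays_forest (add_edge (subdivide e n N) n x) F \<and>
        displays_forest (add_edge (subdivide e n N) n x) F'"
      using c
    proof
      assume "\<exists>y. forest_cherry F x y \<and> forest_cherry F' x y"
      then obtain y where y: "forest_cherry F x y" "forest_cherry F' x y" by blast
      obtain e where e: "e \<in> edges N" "displays_forest (add_edge (subdivide e n N) n x) F" "y \<in> e"
        using displays_minus_leaf[OF F(1) m(1) N False d(1) n', of y] y by blast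
      obtain e' where e': "e' \<in> edges N" "displays_forest (add_edge (subdivide e' n N) n x) F'" "y \<in> e'"
        using displays_minus_leaf[OF F(2) m(2) N False d(2) n', of y] y by blast
      obtain T where "T \<in> F" "y \<in> leaves T" "x \<noteq> y" using y(1) by (auto simp: forest_cherry_def cherry_def)
      then have "y \<in> Y - {x}" using forest_onD(3)[OF F(1)] by blast
      then have "card (incident N y) \<le> Suc 0" using N'(6) by (simp add: degree_def)
      moreover have "finite (incident N y)"
        using simple_graph_finite_edges[OF N'(3)] by (simp add: incident_def)
      ultimately have "e = e'"
        using e e' card_le_Suc0_iff_eq[of "incident N y"] by (auto simp: incident_def)
      then show ?thesis using e e' by blast
    next
      assume "\<exists>T\<in>F. verts T = {x}"
      then obtain T where T: "T \<in> F" "verts T = {x}" by blast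
      obtain e where e: "e \<in> edges N" "displays_forest (add_edge (subdivide e n N) n x) F'"
        using displays_minus_leaf[OF F(2) m(2) N False d(2) n'] by blast
      have "displays_forest (add_edge (subdivide e n N) n x) F"
      proof (rule displays_minus_leaf_single[OF F(1) m(1) T displays_forest_subdivide[OF d(1) n'(1)]])
        show "x \<notin> verts (subdivide e n N)" using n' verts_subdivide_subset[of e n N] by auto
      qed auto
      then show ?thesis using e by blast
    qed
    then obtain e where e: "e \<in> edges N" "displays_forest (add_edge (subdivide e n N) n x) F"
      "displays_forest (add_edge (subdivide e n N) n x) F'" by blast
    have "insert x (Y - {x}) = Y" using xY by blast
    then have "phylo_network Y (add_edge (subdivide e n N) n x)"
      "ret_number (add_edge (subdivide e n N) n x) = ret_number N"
      using phylo_network_add_leaf[OF N e(1) n'] by simp_all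
    moreover have "verts (add_edge (subdivide e n N) n x) \<inter> Q = {}"
      using n Q verts_subdivide_subset[of e n N] by auto
    ultimately show ?thesis using e by blast
  qed
qed

lemma C2_half_minus_edge:
  assumes "C2_half F F' x G G'"
  shows "(\<exists>T e. minus_edge F T e G) \<and> G' = F' \<or> (\<exists>T e. minus_edge F' T e G') \<and> G = F"
  using assms unfolding C2_half_def C2a_def C2b_def C2c_def minus_leaf_edge_def by blast

definition displaying_network ::
  "'v set \<Rightarrow> 'v ugraph set \<Rightarrow> 'v ugraph set \<Rightarrow> int \<Rightarrow> 'v set \<Rightarrow> 'v ugraph \<Rightarrow> bool" where
  "displaying_network Y F F' r Q N \<longleftrightarrow> phylo_network Y N \<and> displays_forest N F \<and> displays_forest N F' \<and>
     ret_number N \<le> r \<and> verts N \<inter> Q = {}"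

lemma displaying_network_commute:
  "displaying_network Y F F' r Q N \<longleftrightarrow> displaying_network Y F' F r Q N"
  by (auto simp: displaying_network_def)

lemma displaying_network_C2_half:
  fixes F F' :: "'v::infinite ugraph set"
  assumes "C2_half F F' x G G'" and F: "forest_on Y F" "forest_on Y F'"
    and G: "forest_on Z G" "forest_on Z' G'" and Q: "finite Q" "Q \<inter> Y = {}"
    and IH: "\<And>Y Q. forest_on Y G \<Longrightarrow> forest_on Y G' \<Longrightarrow> finite Q \<Longrightarrow> Q \<inter> Y = {} \<Longrightarrow>
               \<exists>N. displaying_network Y G G' r Q N"
  shows "\<exists>M. displaying_network Y F F' (r + 1) Q M"
  using C2_half_minus_edge[OF assms(1)]
proof (elim disjE conjE exE)
  fix T e assume m: "minus_edge F T e G" and [simp]: "G' = F'"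
  have "Z = Y" using minus_edge_leaves[OF F(1) m] forest_onD(3)[OF G(1)] by simp
  then obtain N where N: "displaying_network Y G F' r Q N" using IH[of Y Q] F G Q by auto
  then show ?thesis
    using network_minus_edge[OF F(1) m, of N F' Q] Q unfolding displaying_network_def by force
next
  fix T e assume m: "minus_edge F' T e G'" and [simp]: "G = F"
  have "Z' = Y" using minus_edge_leaves[OF F(2) m] forest_onD(3)[OF G(2)] by simp
  then obtain N where N: "displaying_network Y F G' r Q N" using IH[of Y Q] F G Q by auto
  then show ?thesis
    using network_minus_edge[OF F(2) m, of N F Q] Q unfolding displaying_network_def by force
qed

lemma displaying_network_minus_leaf:
  fixes F F' :: "'v::infinite ugraph set"
  assumes F: "forest_on Y F" "forest_on Y F'" and m: "minus_leaf F x G" "minus_leaf F' x G'"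
    and c: "(\<exists>y. forest_cherry F x y \<and> forest_cherry F' x y) \<or> (\<exists>T\<in>F. verts T = {x})"
    and G: "forest_on Z G" "forest_on Z' G'" and Q: "finite Q" "Q \<inter> Y = {}"
    and IH: "\<And>Y Q. forest_on Y G \<Longrightarrow> forest_on Y G' \<Longrightarrow> finite Q \<Longrightarrow> Q \<inter> Y = {} \<Longrightarrow>
               \<exists>N. displaying_network Y G G' r Q N"
  shows "\<exists>M. displaying_network Y F F' r Q M"
proof -
  have Z: "Z = Y - {x}" "Z' = Y - {x}" and x: "x \<in> Y"
    using minus_leaf_leaves[OF F(1) m(1)] minus_leaf_leaves[OF F(2) m(2)]
      forest_onD(3)[OF G(1)] forest_onD(3)[OF G(2)] by simp_all
  have "insert x Q \<inter> (Y - {x}) = {}" using Q by blast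
  then obtain N where N: "displaying_network (Y - {x}) G G' r (insert x Q) N"
    using IH[of "Y - {x}" "insert x Q"] G Q(1) unfolding Z by blast
  have "x \<notin> Q" using x Q by blast
  then show ?thesis
    using network_minus_leaf[OF F m c, of N Q] N Q(1) unfolding displaying_network_def by force
qed

theorem theorem4p5:
  fixes X :: "'v::infinite set"
    and F F' :: "'v ugraph set"
    and \<sigma> :: "'v list"
    and \<Phi> \<Phi>' :: "nat \<Rightarrow> 'v ugraph set"
  assumes "finite X" and "X \<noteq> {}"
    and "forest_on X F" and "forest_on X F'"
    and "cherry_picking_sequence X F F' \<sigma> \<Phi> \<Phi>'"
  shows "\<exists>N :: 'v ugraph. phylo_network X N \<and> displays_forest N F \<and> displays_forest N F' \<and>
           int (weight \<sigma> \<Phi> \<Phi>') \<ge> ret_number N"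
proof -
  let ?m = "length \<sigma> - 1"
  define c :: "nat \<Rightarrow> nat" where "c i =
    (if C1 (\<Phi> i) (\<Phi>' i) (\<sigma> ! i) (\<Phi> (Suc i)) (\<Phi>' (Suc i)) \<or>
        C3 (\<Phi> i) (\<Phi>' i) (\<sigma> ! i) (\<Phi> (Suc i)) (\<Phi>' (Suc i)) then 0 else 1)" for i
  have len: "length \<sigma> \<noteq> 0" using assms(5) by (auto simp: cherry_picking_sequence_def)
  have forests: "(\<exists>Y. forest_on Y (\<Phi> i)) \<and> (\<exists>Y. forest_on Y (\<Phi>' i))" if "i \<le> ?m" for i
    using assms(5) that len unfolding cherry_picking_sequence_def by auto
  have start: "\<Phi> 0 = F" "\<Phi>' 0 = F'" and final: "\<Phi> ?m = {point (last \<sigma>)}" "\<Phi>' ?m = {point (last \<sigma>)}"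
    and picking: "\<And>i. i < ?m \<Longrightarrow> picking_step (\<Phi> i) (\<Phi>' i) (\<sigma> ! i) (\<Phi> (Suc i)) (\<Phi>' (Suc i))"
    using assms(5) by (auto simp: cherry_picking_sequence_def point_def)
  text \<open>Leaves are put back by name, so the network has to avoid the names that come later.\<close>
  have main: "\<exists>N. displaying_network Y (\<Phi> i) (\<Phi>' i) (int (\<Sum>j = i..<?m. c j)) Q N"
    if "i \<le> ?m" "forest_on Y (\<Phi> i)" "forest_on Y (\<Phi>' i)" "finite Q" "Q \<inter> Y = {}" for i Y Q
    using that
  proof (induction i arbitrary: Y Q rule: inc_induct)
    case base
    let ?x = "last \<sigma>"
    have Y: "Y = {?x}" using forest_onD(3)[OF base(1)] final by simp
    have "phylo_network {?x} (point ?x)" by (rule phylo_networkI) auto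
    moreover have "displays_forest (point ?x) {point ?x}"
      using displayed_via_point[of ?x "point ?x"] by (auto simp: displays_forest_def)
    ultimately have "displaying_network Y (\<Phi> ?m) (\<Phi>' ?m) (int (\<Sum>j = ?m..<?m. c j)) Q (point ?x)"
      using base(4) unfolding displaying_network_def final Y by (simp add: ret_number_def)
    then show ?case by blast
  next
    case (step i)
    let ?G = "\<Phi> (Suc i)" and ?G' = "\<Phi>' (Suc i)" and ?r = "int (\<Sum>j = Suc i..<?m. c j)"
    obtain Z Z' where Z: "forest_on Z ?G" "forest_on Z' ?G'" using forests[of "Suc i"] step(2) by auto
    have sum: "int (\<Sum>j = i..<?m. c j) = ?r + int (c i)"
      using step(2) by (simp add: sum.atLeast_Suc_lessThan)
    note IH = step.IH and F = step.prems(1,2) and Q = step.prems(3,4)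
    have IH': "\<exists>N. displaying_network Y ?G' ?G ?r Q N"
      if "forest_on Y ?G'" "forest_on Y ?G" "finite Q" "Q \<inter> Y = {}" for Y Q
      using IH[of Y Q] that displaying_network_commute by metis
    show ?case
    proof (cases "C1 (\<Phi> i) (\<Phi>' i) (\<sigma> ! i) ?G ?G' \<or> C3 (\<Phi> i) (\<Phi>' i) (\<sigma> ! i) ?G ?G'")
      case True
      then have "c i = 0" by (simp add: c_def)
      from True consider
          "(\<exists>y. forest_cherry (\<Phi> i) (\<sigma> ! i) y \<and> forest_cherry (\<Phi>' i) (\<sigma> ! i) y) \<or>
             (\<exists>T\<in>\<Phi> i. verts T = {\<sigma> ! i})"
          "minus_leaf (\<Phi> i) (\<sigma> ! i) ?G" "minus_leaf (\<Phi>' i) (\<sigma> ! i) ?G'"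
        | "\<exists>T\<in>\<Phi>' i. verts T = {\<sigma> ! i}"
          "minus_leaf (\<Phi> i) (\<sigma> ! i) ?G" "minus_leaf (\<Phi>' i) (\<sigma> ! i) ?G'"
        unfolding C1_def C3_def C3_half_def by blast
      then have "\<exists>M. displaying_network Y (\<Phi> i) (\<Phi>' i) ?r Q M"
      proof cases
        case 1
        show ?thesis
          by (rule displaying_network_minus_leaf[OF F 1(2,3,1) Z Q IH])
      next
        case 2
        have "\<exists>M. displaying_network Y (\<Phi>' i) (\<Phi> i) ?r Q M"
          by (rule displaying_network_minus_leaf[OF F(2,1) 2(3,2) disjI2[OF 2(1)] Z(2,1) Q IH'])
        then show ?thesis using displaying_network_commute by metis
      qed
      then show ?thesis unfolding sum \<open>c i = 0\<close> by simp
    next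
      case False
      then have "c i = 1" by (simp add: c_def)
      have "C2 (\<Phi> i) (\<Phi>' i) (\<sigma> ! i) ?G ?G'"
        using picking[OF step(2)] False unfolding picking_step_def by blast
      then have "\<exists>M. displaying_network Y (\<Phi> i) (\<Phi>' i) (?r + 1) Q M"
        unfolding C2_def
      proof
        assume "C2_half (\<Phi> i) (\<Phi>' i) (\<sigma> ! i) ?G ?G'"
        then show ?thesis by (rule displaying_network_C2_half[OF _ F Z Q IH])
      next
        assume "C2_half (\<Phi>' i) (\<Phi> i) (\<sigma> ! i) ?G' ?G"
        then have "\<exists>M. displaying_network Y (\<Phi>' i) (\<Phi> i) (?r + 1) Q M"
          by (rule displaying_network_C2_half[OF _ F(2,1) Z(2,1) Q IH'])
        then show ?thesis using displaying_network_commute by metis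
      qed
      then show ?thesis unfolding sum \<open>c i = 1\<close> by simp
    qed
  qed
  have "weight \<sigma> \<Phi> \<Phi>' = (\<Sum>j = 0..<?m. c j)"
    by (simp add: weight_def c_def atLeast0LessThan)
  then show ?thesis using main[of 0 X "{}"] assms(3,4) start
    unfolding displaying_network_def by auto
qed

end
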